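(* Let $W\models ZFC$ and let $\mathbb{P}\in W$ be a forcing notion. Let $T\subseteq\mathbb{P}$ be a $W$-generic filter and let $\theta$ be a regular cardinal in $W[T]$. Assume that $\mathbb{P}$ is $\theta$-cc in $W[T]$. Then in $W[T]$ there are no fresh subsets, with respect to $W$, of cardinals $\lambda$ such that $\mathrm{cf}(\lambda)=\theta$.
   Context: For $ZFC$ models $M\subseteq M'$, a set of ordinals $X\in M'\setminus M$ is fresh with respect to $M$ if $X\cap\alpha\in M$ for every $\alpha<\sup(X)$. "$\mathbb P$ is $\theta$-cc in $W[T]$" means that in $W[T]$ every antichain of $\mathbb P$ has size less than $\theta$.
   Formalization: A fresh subset of λ is taken to be unbounded in λ (sup X = λ); for bounded subsets the claim fails: adding a Cohen real X ⊆ ω with θ = λ = ω₁ gives a fresh X ⊆ ω₁ although the forcing is ω₁-cc. *)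

theory Defs
  imports Main
begin

section \<open>The ambient universe\<close>

text \<open>
  A type of this class carries a well-founded extensional membership relation; up to isomorphism
  (Mostowski collapse) it is a transitive class of sets with the true membership relation.  No
  closure conditions are imposed, so that every well-founded model of set theory, together with any
  well-founded extension of it, can occur inside such a universe.
\<close>

class set_universe =
  fixes elem :: "'a \<Rightarrow> 'a \<Rightarrow> bool"  (infix "\<^bold>\<in>" 50)
  assumes elem_extensional: "(\<And>z. z \<^bold>\<in> x \<longleftrightarrow> z \<^bold>\<in> y) \<Longrightarrow> x = y"
    and elem_wf: "wf {(x, y). x \<^bold>\<in> y}"

definition elts :: "'v::set_universe \<Rightarrow> 'v set" where
  "elts x = {z. z \<^bold>\<in> x}"

definition transitive_class :: "'v::set_universe set \<Rightarrow> bool" where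
  "transitive_class M \<longleftrightarrow> (\<forall>x\<in>M. elts x \<subseteq> M)"

section \<open>First-order formulas and models of ZFC\<close>

datatype fm = Member nat nat | Equal nat nat | Neg fm | Conj fm fm | Forall nat fm

primrec sat :: "'v::set_universe set \<Rightarrow> (nat \<Rightarrow> 'v) \<Rightarrow> fm \<Rightarrow> bool" where
  "sat M e (Member i j) \<longleftrightarrow> e i \<^bold>\<in> e j"
| "sat M e (Equal i j) \<longleftrightarrow> e i = e j"
| "sat M e (Neg \<phi>) \<longleftrightarrow> \<not> sat M e \<phi>"
| "sat M e (Conj \<phi> \<psi>) \<longleftrightarrow> sat M e \<phi> \<and> sat M e \<psi>"
| "sat M e (Forall i \<phi>) \<longleftrightarrow> (\<forall>x\<in>M. sat M (e(i := x)) \<phi>)"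

text \<open>
  The single axioms are written out as their relativizations to \<open>M\<close>.  In the two schemas the
  variables \<open>0\<close> (and \<open>1\<close>) of the formula are the displayed ones and the remaining variables are
  parameters from \<open>M\<close>.
\<close>

definition Extensionality_ax :: "'v::set_universe set \<Rightarrow> bool" where
  "Extensionality_ax M \<longleftrightarrow>
     (\<forall>x\<in>M. \<forall>y\<in>M. (\<forall>z\<in>M. z \<^bold>\<in> x \<longleftrightarrow> z \<^bold>\<in> y) \<longrightarrow> x = y)"

definition Foundation_ax :: "'v::set_universe set \<Rightarrow> bool" where
  "Foundation_ax M \<longleftrightarrow>
     (\<forall>x\<in>M. (\<exists>y\<in>M. y \<^bold>\<in> x) \<longrightarrow> (\<exists>y\<in>M. y \<^bold>\<in> x \<and> \<not> (\<exists>z\<in>M. z \<^bold>\<in> x \<and> z \<^bold>\<in> y)))"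

definition Pairing_ax :: "'v::set_universe set \<Rightarrow> bool" where
  "Pairing_ax M \<longleftrightarrow>
     (\<forall>x\<in>M. \<forall>y\<in>M. \<exists>u\<in>M. \<forall>z\<in>M. z \<^bold>\<in> u \<longleftrightarrow> z = x \<or> z = y)"

definition Union_ax :: "'v::set_universe set \<Rightarrow> bool" where
  "Union_ax M \<longleftrightarrow>
     (\<forall>x\<in>M. \<exists>u\<in>M. \<forall>z\<in>M. z \<^bold>\<in> u \<longleftrightarrow> (\<exists>y\<in>M. y \<^bold>\<in> x \<and> z \<^bold>\<in> y))"

definition Power_set_ax :: "'v::set_universe set \<Rightarrow> bool" where
  "Power_set_ax M \<longleftrightarrow>
     (\<forall>x\<in>M. \<exists>u\<in>M. \<forall>z\<in>M. z \<^bold>\<in> u \<longleftrightarrow> (\<forall>w\<in>M. w \<^bold>\<in> z \<longrightarrow> w \<^bold>\<in> x))"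

definition Infinity_ax :: "'v::set_universe set \<Rightarrow> bool" where
  "Infinity_ax M \<longleftrightarrow>
     (\<exists>u\<in>M. (\<exists>x\<in>M. x \<^bold>\<in> u \<and> (\<forall>z\<in>M. \<not> z \<^bold>\<in> x)) \<and>
       (\<forall>x\<in>M. x \<^bold>\<in> u \<longrightarrow> (\<exists>s\<in>M. s \<^bold>\<in> u \<and> (\<forall>z\<in>M. z \<^bold>\<in> s \<longleftrightarrow> z \<^bold>\<in> x \<or> z = x))))"

definition Separation_schema :: "'v::set_universe set \<Rightarrow> bool" where
  "Separation_schema M \<longleftrightarrow>
     (\<forall>\<phi> e. range e \<subseteq> M \<longrightarrow>
       (\<forall>a\<in>M. \<exists>u\<in>M. \<forall>z\<in>M. z \<^bold>\<in> u \<longleftrightarrow> z \<^bold>\<in> a \<and> sat M (e(0 := z)) \<phi>))"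

definition Replacement_schema :: "'v::set_universe set \<Rightarrow> bool" where
  "Replacement_schema M \<longleftrightarrow>
     (\<forall>\<phi> e. range e \<subseteq> M \<longrightarrow>
       (\<forall>a\<in>M.
         (\<forall>x\<in>M. x \<^bold>\<in> a \<longrightarrow> (\<exists>!y. y \<in> M \<and> sat M (e(0 := x, 1 := y)) \<phi>)) \<longrightarrow>
         (\<exists>u\<in>M. \<forall>y\<in>M. y \<^bold>\<in> u \<longleftrightarrow> (\<exists>x\<in>M. x \<^bold>\<in> a \<and> sat M (e(0 := x, 1 := y)) \<phi>))))"

definition Choice_ax :: "'v::set_universe set \<Rightarrow> bool" where
  "Choice_ax M \<longleftrightarrow>
     (\<forall>a\<in>M.
       (\<forall>x\<in>M. x \<^bold>\<in> a \<longrightarrow> (\<exists>z\<in>M. z \<^bold>\<in> x)) \<and>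
       (\<forall>x\<in>M. \<forall>y\<in>M. x \<^bold>\<in> a \<and> y \<^bold>\<in> a \<and> x \<noteq> y \<longrightarrow> \<not> (\<exists>z\<in>M. z \<^bold>\<in> x \<and> z \<^bold>\<in> y)) \<longrightarrow>
       (\<exists>c\<in>M. \<forall>x\<in>M. x \<^bold>\<in> a \<longrightarrow> (\<exists>!z. z \<in> M \<and> z \<^bold>\<in> x \<and> z \<^bold>\<in> c)))"

definition ZFC_model :: "'v::set_universe set \<Rightarrow> bool" where
  "ZFC_model M \<longleftrightarrow> M \<noteq> {} \<and>
     Extensionality_ax M \<and> Foundation_ax M \<and> Pairing_ax M \<and> Union_ax M \<and> Power_set_ax M \<and>
     Infinity_ax M \<and> Separation_schema M \<and> Replacement_schema M \<and> Choice_ax M"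

section \<open>Pairs, functions, ordinals and cardinals\<close>

text \<open>Kuratowski pairs: \<open>z = {{x}, {x, y}}\<close>.\<close>

definition is_pair :: "'v::set_universe \<Rightarrow> 'v \<Rightarrow> 'v \<Rightarrow> bool" where
  "is_pair z x y \<longleftrightarrow> (\<exists>a b. elts z = {a, b} \<and> elts a = {x} \<and> elts b = {x, y})"

definition rel_of :: "'v::set_universe \<Rightarrow> ('v \<times> 'v) set" where
  "rel_of r = {(x, y). \<exists>z. z \<^bold>\<in> r \<and> is_pair z x y}"

definition is_graph :: "'v::set_universe \<Rightarrow> 'v \<Rightarrow> ('v \<Rightarrow> 'v) \<Rightarrow> bool" where
  "is_graph f A g \<longleftrightarrow> (\<forall>z. z \<^bold>\<in> f \<longleftrightarrow> (\<exists>x. x \<^bold>\<in> A \<and> is_pair z x (g x)))"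

definition is_ordinal :: "'v::set_universe \<Rightarrow> bool" where
  "is_ordinal x \<longleftrightarrow> (\<forall>y\<in>elts x. elts y \<subseteq> elts x) \<and> (\<forall>y\<in>elts x. \<forall>z\<in>elts y. elts z \<subseteq> elts y)"

definition ord_le :: "'v::set_universe \<Rightarrow> 'v \<Rightarrow> bool" where
  "ord_le x y \<longleftrightarrow> x \<^bold>\<in> y \<or> x = y"

definition is_sup :: "'v::set_universe \<Rightarrow> 'v \<Rightarrow> bool" where
  "is_sup X s \<longleftrightarrow> is_ordinal s \<and> (\<forall>\<xi>\<in>elts X. ord_le \<xi> s) \<and>
     (\<forall>t. is_ordinal t \<and> (\<forall>\<xi>\<in>elts X. ord_le \<xi> t) \<longrightarrow> ord_le s t)"

text \<open>
  In the following notions the argument \<open>M\<close> is the transitive model in which they are computed: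
  the functions witnessing them are required to be elements of \<open>M\<close>.
\<close>

definition equinumerous :: "'v::set_universe set \<Rightarrow> 'v \<Rightarrow> 'v \<Rightarrow> bool" where
  "equinumerous M A B \<longleftrightarrow> (\<exists>f\<in>M. \<exists>g. is_graph f A g \<and> bij_betw g (elts A) (elts B))"

definition is_cardinal :: "'v::set_universe set \<Rightarrow> 'v \<Rightarrow> bool" where
  "is_cardinal M \<kappa> \<longleftrightarrow> \<kappa> \<in> M \<and> is_ordinal \<kappa> \<and> (\<forall>\<mu>\<in>elts \<kappa>. \<not> equinumerous M \<mu> \<kappa>)"

definition size_less :: "'v::set_universe set \<Rightarrow> 'v \<Rightarrow> 'v \<Rightarrow> bool" where
  "size_less M A \<theta> \<longleftrightarrow> (\<exists>\<kappa>. is_cardinal M \<kappa> \<and> equinumerous M A \<kappa> \<and> \<kappa> \<^bold>\<in> \<theta>)"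

definition cofinal_map_exists :: "'v::set_universe set \<Rightarrow> 'v \<Rightarrow> 'v \<Rightarrow> bool" where
  "cofinal_map_exists M \<mu> \<kappa> \<longleftrightarrow>
     (\<exists>f\<in>M. \<exists>g. is_graph f \<mu> g \<and> g ` elts \<mu> \<subseteq> elts \<kappa> \<and>
        (\<forall>\<xi>\<in>elts \<kappa>. \<exists>i\<in>elts \<mu>. ord_le \<xi> (g i)))"

definition has_cofinality :: "'v::set_universe set \<Rightarrow> 'v \<Rightarrow> 'v \<Rightarrow> bool" where
  "has_cofinality M \<kappa> \<theta> \<longleftrightarrow> \<theta> \<in> M \<and> is_ordinal \<theta> \<and> cofinal_map_exists M \<theta> \<kappa> \<and>
     (\<forall>\<mu>\<in>elts \<theta>. \<not> cofinal_map_exists M \<mu> \<kappa>)"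

text \<open>Regular cardinals are infinite; for ordinals this is absolute, since membership is well-founded.\<close>

definition is_regular_cardinal :: "'v::set_universe set \<Rightarrow> 'v \<Rightarrow> bool" where
  "is_regular_cardinal M \<theta> \<longleftrightarrow>
     is_cardinal M \<theta> \<and> infinite (elts \<theta>) \<and> has_cofinality M \<theta> \<theta>"

section \<open>Forcing\<close>

text \<open>
  A forcing notion is a nonempty preorder; \<open>(p, q) \<in> rel_of leq\<close> means that \<open>p\<close> is stronger
  than \<open>q\<close>.
\<close>

definition forcing_notion :: "'v::set_universe \<Rightarrow> 'v \<Rightarrow> bool" where
  "forcing_notion P leq \<longleftrightarrow> elts P \<noteq> {} \<and> preorder_on (elts P) (rel_of leq)"

definition compatible :: "'v::set_universe \<Rightarrow> 'v \<Rightarrow> 'v \<Rightarrow> 'v \<Rightarrow> bool" where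
  "compatible P leq p q \<longleftrightarrow> (\<exists>r\<in>elts P. (r, p) \<in> rel_of leq \<and> (r, q) \<in> rel_of leq)"

definition antichain :: "'v::set_universe \<Rightarrow> 'v \<Rightarrow> 'v \<Rightarrow> bool" where
  "antichain P leq A \<longleftrightarrow> elts A \<subseteq> elts P \<and>
     (\<forall>p\<in>elts A. \<forall>q\<in>elts A. p \<noteq> q \<longrightarrow> \<not> compatible P leq p q)"

definition chain_condition :: "'v::set_universe set \<Rightarrow> 'v \<Rightarrow> 'v \<Rightarrow> 'v \<Rightarrow> bool" where
  "chain_condition M P leq \<theta> \<longleftrightarrow> (\<forall>A\<in>M. antichain P leq A \<longrightarrow> size_less M A \<theta>)"

definition dense_in :: "'v::set_universe \<Rightarrow> 'v \<Rightarrow> 'v \<Rightarrow> bool" where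
  "dense_in P leq D \<longleftrightarrow> elts D \<subseteq> elts P \<and>
     (\<forall>p\<in>elts P. \<exists>q\<in>elts D. (q, p) \<in> rel_of leq)"

definition is_filter :: "'v::set_universe \<Rightarrow> 'v \<Rightarrow> 'v set \<Rightarrow> bool" where
  "is_filter P leq T \<longleftrightarrow> T \<subseteq> elts P \<and> T \<noteq> {} \<and>
     (\<forall>p\<in>T. \<forall>q\<in>elts P. (p, q) \<in> rel_of leq \<longrightarrow> q \<in> T) \<and>
     (\<forall>p\<in>T. \<forall>q\<in>T. \<exists>r\<in>T. (r, p) \<in> rel_of leq \<and> (r, q) \<in> rel_of leq)"

definition generic_filter :: "'v::set_universe set \<Rightarrow> 'v \<Rightarrow> 'v \<Rightarrow> 'v set \<Rightarrow> bool" where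
  "generic_filter W P leq T \<longleftrightarrow> is_filter P leq T \<and>
     (\<forall>D\<in>W. dense_in P leq D \<longrightarrow> T \<inter> elts D \<noteq> {})"

inductive P_name :: "'v::set_universe \<Rightarrow> 'v \<Rightarrow> bool" for P where
  "(\<forall>z\<in>elts \<tau>. \<exists>\<sigma> p. is_pair z \<sigma> p \<and> p \<^bold>\<in> P \<and> P_name P \<sigma>) \<Longrightarrow> P_name P \<tau>"

text \<open>
  \<open>generic_extension W P T N\<close> says that \<open>N\<close> is \<open>W[T] = {val(\<tau>) | \<tau> \<in> W is a P-name}\<close>, where
  \<open>val(\<tau>) = {val(\<sigma>) | (\<sigma>, p) \<in> \<tau>, p \<in> T}\<close>.  By well-foundedness and extensionality the recursion
  determines \<open>val\<close> on the names in \<open>W\<close>, hence \<open>N\<close>, uniquely; the existential quantifier only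
  expresses that these evaluations belong to the ambient universe.
\<close>

definition generic_extension :: "'v::set_universe set \<Rightarrow> 'v \<Rightarrow> 'v set \<Rightarrow> 'v set \<Rightarrow> bool" where
  "generic_extension W P T N \<longleftrightarrow>
     (\<exists>val. (\<forall>\<tau>\<in>W. P_name P \<tau> \<longrightarrow>
               elts (val \<tau>) = {val \<sigma> | \<sigma> p. p \<in> T \<and> (\<sigma>, p) \<in> rel_of \<tau>}) \<and>
            N = val ` {\<tau>\<in>W. P_name P \<tau>})"

section \<open>Fresh sets\<close>

definition fresh :: "'v::set_universe set \<Rightarrow> 'v set \<Rightarrow> 'v \<Rightarrow> bool" where
  "fresh M M' X \<longleftrightarrow> X \<in> M' - M \<and> (\<forall>\<xi>\<in>elts X. is_ordinal \<xi>) \<and>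
     (\<exists>s. is_sup X s \<and> (\<forall>\<alpha>\<in>elts s. \<exists>y\<in>M. elts y = elts X \<inter> elts \<alpha>))"

text \<open>
  A fresh subset of \<open>\<kappa>\<close> is understood to be unbounded in \<open>\<kappa>\<close>, i.e. to have supremum \<open>\<kappa>\<close>:
  a fresh set bounded in \<open>\<kappa>\<close> is a fresh subset of its own supremum, whose cofinality is unrelated
  to that of \<open>\<kappa>\<close>.  For limit \<open>\<kappa>\<close> and models of ZFC this is equivalent to \<open>X \<subseteq> \<kappa>\<close>,
  \<open>X \<in> M' - M\<close> and \<open>X \<inter> \<alpha> \<in> M\<close> for all \<open>\<alpha> < \<kappa>\<close>.
\<close>

definition fresh_subset :: "'v::set_universe set \<Rightarrow> 'v set \<Rightarrow> 'v \<Rightarrow> 'v \<Rightarrow> bool" where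
  "fresh_subset M M' X \<kappa> \<longleftrightarrow> fresh M M' X \<and> elts X \<subseteq> elts \<kappa> \<and> is_sup X \<kappa>"

end

theory Submission
  imports Defs
begin

text \<open>
  Let \<open>X\<close> be a fresh subset of \<open>\<kappa>\<close> and \<open>D\<close> the set of conditions that decide some \<open>\<alpha> \<in> X\<close> wrongly.
  Choose, in \<open>W[T]\<close>, a maximal antichain \<open>A\<close> of \<open>D\<close> and for each \<open>q \<in> A\<close> some \<open>\<alpha>\<close> on which \<open>q\<close> is
  wrong.  As \<open>A\<close> has size less than \<open>\<theta> = cf(\<kappa>)\<close>, these \<open>\<alpha>\<close> are bounded by some \<open>\<xi> < \<kappa>\<close>.  Since
  \<open>X \<inter> \<xi> \<in> W\<close>, some \<open>p \<in> T\<close> decides \<open>X \<inter> \<xi>\<close> correctly, hence is incompatible with every element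
  of \<open>A\<close>; by maximality no extension of \<open>p\<close> lies in \<open>D\<close>, so \<open>p\<close> decides all of \<open>X\<close> and \<open>X \<in> W\<close>.

  The forcing theorem for arbitrary formulas and the axioms of ZFC in \<open>W[T]\<close> are avoided.  The pair
  of \<open>A\<close> and the choice of \<open>\<alpha>\<close> is read off from a maximal set \<open>V \<in> W\<close> of triples \<open>(p, q, \<alpha>)\<close> in which
  \<open>p\<close> and \<open>q\<close> decide \<open>\<alpha> \<in> X\<close> differently, distinct triples being incompatible in the first or in
  the second coordinate: \<open>A\<close> consists of the \<open>q\<close> for which \<open>p \<in> T\<close> for some \<open>(p, q, \<alpha>) \<in> V\<close>.
\<close>

section \<open>Sets, pairs and ordinals in the ambient universe\<close>

text \<open>The obstacle is that being wrong refers to X, which is not in \<open>W\<close>, so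
  neither \<open>D\<close> nor \<open>A\<close> can be handled inside \<open>W\<close>, where
  genericity and maximality arguments take place. In a triple of \<open>V\<close> the first
  coordinate p stands for the truth: if p is in \<open>T\<close>, then p decides \<alpha> correctly
  and a q that disagrees with p is wrong. Members of \<open>T\<close> are pairwise compatible, so
  distinct triples of \<open>V\<close> with first coordinates in \<open>T\<close> must be
  incompatible in the second one; hence \<open>A\<close> is an antichain and \<alpha> is a function
  of q. A density argument turns maximality of \<open>V\<close> into the fact that every wrong
  condition is compatible with some member of \<open>A\<close>.

  The hypotheses about \<open>W[T]\<close> apply only to sets shown to lie there: to
  \<open>A\<close> and to the map that sends the index of q, in the enumeration of \<open>A\<close>
  given by the chain condition, to \<alpha>. Both are produced from codes in \<open>W\<close>,
  relations between conditions and elements; conversely every subset in \<open>W[T]\<close> of a set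
  of \<open>W\<close> has a code. Forcing is then needed only for two kinds of statements: that a
  name denotes a given element of \<open>W\<close>, and that an element belongs to a coded
  set.\<close>

lemma elem_iff: "x \<^bold>\<in> y \<longleftrightarrow> x \<in> elts y"
  by (simp add: elts_def)

lemma elts_inject [simp]: "elts x = elts y \<longleftrightarrow> x = y"
  using elem_extensional[of x y] by (auto simp: elts_def)

lemma elem_induct [case_names step]:
  assumes "\<And>x. (\<And>y. y \<in> elts x \<Longrightarrow> Q y) \<Longrightarrow> Q x"
  shows "Q x"
  using elem_wf by (induction x rule: wf_induct_rule) (auto intro: assms simp: elem_iff)

lemma elem_irrefl [simp]: "x \<notin> elts x"
  using elem_wf by (metis (mono_tags) elem_iff case_prodI mem_Collect_eq wf_not_refl)

lemma elem_asym: "x \<in> elts y \<Longrightarrow> y \<notin> elts x"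
  using elem_wf by (metis (mono_tags) elem_iff case_prodI mem_Collect_eq wf_not_sym)

text \<open>The ambient universe has no closure properties, so a HOL set need not be the extension
  of an element. The value is meaningful only if it is; inside \<open>W\<close> this is what
  \<open>is_set\<close> provides.\<close>

definition the_set :: "'v::set_universe set \<Rightarrow> 'v" where
  "the_set A = (THE u. elts u = A)"

lemma the_set_eq: "elts u = A \<Longrightarrow> the_set A = u"
  unfolding the_set_def by (rule the_equality) auto

lemma is_pair_unique: "is_pair z x y \<Longrightarrow> is_pair z' x y \<Longrightarrow> z = z'"
  unfolding is_pair_def by (metis elts_inject)

lemma is_pair_inject:
  assumes "is_pair z x y" "is_pair z x' y'"
  shows "x = x' \<and> y = y'"
proof -
  obtain a b a' b' where *: "elts z = {a, b}" "elts a = {x}" "elts b = {x, y}"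
    "elts z = {a', b'}" "elts a' = {x'}" "elts b' = {x', y'}"
    using assms unfolding is_pair_def by blast
  have "{a, b} = {a', b'}" using * by simp
  then have "a = a' \<and> b = b' \<or> a = b' \<and> b = a'" by (simp add: doubleton_eq_iff)
  then show ?thesis using *(2,3,5,6) by (metis doubleton_eq_iff insert_absorb2)
qed

definition pair :: "'v::set_universe \<Rightarrow> 'v \<Rightarrow> 'v" where
  "pair x y = (THE z. is_pair z x y)"

lemma pair_eq: "is_pair z x y \<Longrightarrow> pair x y = z"
  unfolding pair_def by (rule the_equality) (auto intro: is_pair_unique)

lemma is_ordinal_elem: "is_ordinal x \<Longrightarrow> y \<in> elts x \<Longrightarrow> is_ordinal y"
  unfolding is_ordinal_def by blast

lemma is_ordinal_trans: "is_ordinal x \<Longrightarrow> y \<in> elts x \<Longrightarrow> z \<in> elts y \<Longrightarrow> z \<in> elts x"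
  unfolding is_ordinal_def by blast

text \<open>Nested induction: by the outer hypothesis every element of x is comparable with y, by
  the inner one every element of y is comparable with x. If x and y were incomparable, transitivity
  would leave each element of one only the option of lying in the other, and extensionality would
  make x and y equal.\<close>

lemma is_ordinal_linear:
  "is_ordinal x \<Longrightarrow> is_ordinal y \<Longrightarrow> x \<in> elts y \<or> x = y \<or> y \<in> elts x"
proof (induction x arbitrary: y rule: elem_induct)
  case (step x)
  note outer = step
  show ?case using \<open>is_ordinal y\<close>
  proof (induction y rule: elem_induct)
    case (step y)
    show ?case
    proof (rule ccontr)
      assume *: "\<not> ?thesis"
      have "z \<in> elts y" if "z \<in> elts x" for z
        using outer(1)[OF that is_ordinal_elem[OF outer(2) that] step(2)] that *
          is_ordinal_trans[OF outer(2) that] by blast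
      moreover have "z \<in> elts x" if "z \<in> elts y" for z
        using step(1)[OF that is_ordinal_elem[OF step(2) that]] that *
          is_ordinal_trans[OF step(2) that] by blast
      ultimately have "elts x = elts y" by blast
      with * show False by simp
    qed
  qed
qed

lemma is_ordinal_subset:
  "is_ordinal x \<Longrightarrow> is_ordinal y \<Longrightarrow> elts x \<subseteq> elts y \<Longrightarrow> x \<in> elts y \<or> x = y"
  using is_ordinal_linear[of x y] by (metis elem_irrefl subsetD)

lemma is_sup_unique: "is_sup X s \<Longrightarrow> is_sup X t \<Longrightarrow> s = t"
  unfolding is_sup_def ord_le_def elem_iff by (metis elem_asym)

section \<open>Definability over a transitive model\<close>

primrec ren :: "(nat \<Rightarrow> nat) \<Rightarrow> fm \<Rightarrow> fm" where
  "ren f (Member i j) = Member (f i) (f j)"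
| "ren f (Equal i j) = Equal (f i) (f j)"
| "ren f (Neg \<phi>) = Neg (ren f \<phi>)"
| "ren f (Conj \<phi> \<psi>) = Conj (ren f \<phi>) (ren f \<psi>)"
| "ren f (Forall i \<phi>) = Forall (f i) (ren f \<phi>)"

text \<open>Bound variables are renamed together with free ones, so injectivity alone excludes
  capture and free variables need not be tracked.\<close>

lemma sat_ren: "inj f \<Longrightarrow> sat M e (ren f \<phi>) = sat M (e \<circ> f) \<phi>"
proof (induction \<phi> arbitrary: e)
  case (Forall i \<phi>)
  have "(e(f i := x)) \<circ> f = (e \<circ> f)(i := x)" for x
    using Forall.prems by (auto simp: fun_eq_iff inj_def)
  then show ?case unfolding ren.simps sat.simps Forall.IH[OF Forall.prems] by metis
qed auto

text \<open>Environments interleave the free variables (even positions) with parameters (odd positions).\<close>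

definition merge :: "(nat \<Rightarrow> 'v) \<Rightarrow> (nat \<Rightarrow> 'v) \<Rightarrow> nat \<Rightarrow> 'v" where
  "merge e c n = (if even n then e (n div 2) else c (n div 2))"

locale transitive_zfc =
  fixes W :: "'v::set_universe set"
  assumes transitive: "transitive_class W" and zfc: "ZFC_model W"
begin

lemma elts_in: "x \<in> W \<Longrightarrow> y \<in> elts x \<Longrightarrow> y \<in> W"
  using transitive unfolding transitive_class_def by blast

abbreviation env :: "(nat \<Rightarrow> 'v) \<Rightarrow> bool" where
  "env e \<equiv> range e \<subseteq> W"

lemma env_app: "env e \<Longrightarrow> e i \<in> W"
  by blast

text \<open>Definability with parameters, as a property of HOL predicates on environments. Closure
  rules replace explicit formulas, and the parameters stay hidden in the existentially quantified
  sequence c.\<close>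

definition definable :: "((nat \<Rightarrow> 'v) \<Rightarrow> bool) \<Rightarrow> bool" where
  "definable Q \<longleftrightarrow> (\<exists>\<phi> c. env c \<and> (\<forall>e. env e \<longrightarrow> (Q e \<longleftrightarrow> sat W (merge e c) \<phi>)))"

lemma definableI:
  "env c \<Longrightarrow> (\<And>e. env e \<Longrightarrow> Q e \<longleftrightarrow> sat W (merge e c) \<phi>) \<Longrightarrow> definable Q"
  unfolding definable_def by blast

lemma definable_cong:
  "definable Q \<Longrightarrow> (\<And>e. env e \<Longrightarrow> Q' e \<longleftrightarrow> Q e) \<Longrightarrow> definable Q'"
  unfolding definable_def by meson

lemma nonempty: "\<exists>w. w \<in> W"
  using zfc unfolding ZFC_model_def by blast

lemma definable_mem_var: "definable (\<lambda>e. e i \<in> elts (e j))"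
proof -
  obtain w where "w \<in> W" using nonempty by blast
  then show ?thesis
    by (intro definableI[of "\<lambda>_. w" _ "Member (2 * i) (2 * j)"]) (auto simp: merge_def elem_iff)
qed

lemma definable_eq_var: "definable (\<lambda>e. e i = e j)"
proof -
  obtain w where "w \<in> W" using nonempty by blast
  then show ?thesis
    by (intro definableI[of "\<lambda>_. w" _ "Equal (2 * i) (2 * j)"]) (auto simp: merge_def)
qed

lemma definable_eq_const: "c \<in> W \<Longrightarrow> definable (\<lambda>e. e i = c)"
  by (intro definableI[of "\<lambda>_. c" _ "Equal (2 * i) 1"]) (auto simp: merge_def)

lemma definable_rename:
  assumes "definable Q" "inj f"
  shows "definable (\<lambda>e. Q (\<lambda>n. e (f n)))"
proof -
  obtain \<phi> c where c: "env c" and \<phi>: "\<And>e. env e \<Longrightarrow> Q e \<longleftrightarrow> sat W (merge e c) \<phi>"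
    using assms(1) unfolding definable_def by blast
  \<comment> \<open>\<open>g\<close> follows \<open>f\<close> on the even positions, which hold the
    free variables, and leaves the parameters at the odd positions in place.\<close>
  define g where "g n = (if even n then 2 * f (n div 2) else n)" for n
  have even_g: "even (g n) \<longleftrightarrow> even n" for n
    by (simp add: g_def)
  have g: "inj g"
  proof (rule injI)
    fix x y assume xy: "g x = g y"
    then have "even x \<longleftrightarrow> even y" using even_g by metis
    then show "x = y" using xy assms(2) by (auto simp: g_def inj_eq elim!: evenE)
  qed
  have m: "merge (\<lambda>n. e (f n)) c = merge e c \<circ> g" for e
    by (auto simp: merge_def g_def fun_eq_iff)
  show ?thesis
  proof (rule definableI[OF c, of _ "ren g \<phi>"])
    fix e assume "env e"
    then have "env (\<lambda>n. e (f n))" by blast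
    from \<phi>[OF this] show "Q (\<lambda>n. e (f n)) \<longleftrightarrow> sat W (merge e c) (ren g \<phi>)"
      by (simp add: sat_ren[OF g] m[symmetric])
  qed
qed

lemma definable_not: "definable Q \<Longrightarrow> definable (\<lambda>e. \<not> Q e)"
  unfolding definable_def by (meson sat.simps(3))

lemma definable_conj:
  assumes "definable Q" "definable R"
  shows "definable (\<lambda>e. Q e \<and> R e)"
proof -
  obtain \<phi> c where c: "env c" and \<phi>: "\<And>e. env e \<Longrightarrow> Q e \<longleftrightarrow> sat W (merge e c) \<phi>"
    using assms(1) unfolding definable_def by blast
  obtain \<psi> d where d: "env d" and \<psi>: "\<And>e. env e \<Longrightarrow> R e \<longleftrightarrow> sat W (merge e d) \<psi>"
    using assms(2) unfolding definable_def by blast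
  \<comment> \<open>The two parameter sequences are interleaved into one: position 2m+1 moves to
    4m+1 under \<open>f\<close> and to 4m+3 under \<open>g\<close>, while the free variables keep
    their even positions.\<close>
  define f where "f n = (if even n then n else 2 * n - 1)" for n :: nat
  define g where "g n = (if even n then n else 2 * n + 1)" for n :: nat
  have f: "inj f" unfolding f_def inj_def by (auto split: if_splits; presburger)
  have g: "inj g" unfolding g_def inj_def by (auto split: if_splits; presburger)
  have f_odd: "f (Suc (2 * m)) = Suc (2 * (2 * m))" and g_odd: "g (Suc (2 * m)) = Suc (2 * Suc (2 * m))" for m
    by (simp_all add: f_def g_def)
  have mf: "merge e c n = (merge e (merge c d) \<circ> f) n" for e n
  proof (cases "even n")
    case False
    then obtain m where "n = Suc (2 * m)" by (auto elim: oddE)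
    then show ?thesis by (simp only: o_apply f_odd) (simp add: merge_def)
  qed (simp add: merge_def f_def)
  have mg: "merge e d n = (merge e (merge c d) \<circ> g) n" for e n
  proof (cases "even n")
    case False
    then obtain m where "n = Suc (2 * m)" by (auto elim: oddE)
    then show ?thesis by (simp only: o_apply g_odd) (simp add: merge_def)
  qed (simp add: merge_def g_def)
  have mf: "merge e c = merge e (merge c d) \<circ> f" and mg: "merge e d = merge e (merge c d) \<circ> g" for e
    using mf mg by auto
  have "env (merge c d)" using c d by (auto simp: merge_def)
  then show ?thesis
    by (rule definableI[of _ _ "Conj (ren f \<phi>) (ren g \<psi>)"])
      (use \<phi> \<psi> in \<open>auto simp: sat_ren[OF f] sat_ren[OF g] mf[symmetric] mg[symmetric]\<close>)
qed

text \<open>In the premises of the quantifier rules the bound variable has index \<open>0\<close> and the outer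
  environment is \<open>\<lambda>n. e (Suc n)\<close>, so that \<open>intro\<close> reduces definability goals by unification.\<close>

lemma definable_all:
  assumes "definable (\<lambda>e. Q (e 0) (\<lambda>n. e (Suc n)))"
  shows "definable (\<lambda>e. \<forall>x\<in>W. Q x e)"
proof -
  obtain \<phi> c where c: "env c"
    and \<phi>: "\<And>e. env e \<Longrightarrow> Q (e 0) (\<lambda>n. e (Suc n)) \<longleftrightarrow> sat W (merge e c) \<phi>"
    using assms unfolding definable_def by blast
  \<comment> \<open>The bound variable moves from position 0 to position 1, the remaining free
    variables move down by one even place, and the parameters move up by one odd place to vacate
    position 1. The sequence \<open>\<lambda>n. c (n - 1)\<close> accounts for the last
    shift.\<close>
  define f where "f n = (if n = 0 then 1 else if even n then n - 2 else n + 2)" for n :: nat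
  have f: "inj f" unfolding f_def inj_def by (auto split: if_splits; presburger)
  have m: "(merge e (\<lambda>n. c (n - 1)))(Suc 0 := x) \<circ> f = merge (case_nat x e) c" for e x
    by (auto simp: merge_def f_def fun_eq_iff elim!: oddE evenE split: nat.splits)
  have "Q x e \<longleftrightarrow> sat W ((merge e (\<lambda>n. c (n - 1)))(Suc 0 := x)) (ren f \<phi>)" if "env e" "x \<in> W" for e x
  proof -
    have "env (case_nat x e)" using that by (force split: nat.splits)
    from \<phi>[OF this] show ?thesis using that unfolding sat_ren[OF f] m by simp
  qed
  moreover have "env (\<lambda>n. c (n - 1))" using c by auto
  ultimately show ?thesis
    by (intro definableI[of "\<lambda>n. c (n - 1)" _ "Forall 1 (ren f \<phi>)"]) auto
qed

lemma definable_ex: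
  assumes "definable (\<lambda>e. Q (e 0) (\<lambda>n. e (Suc n)))"
  shows "definable (\<lambda>e. \<exists>x\<in>W. Q x e)"
proof -
  have "definable (\<lambda>e. \<not> (\<forall>x\<in>W. \<not> Q x e))"
    by (intro definable_not definable_all assms)
  then show ?thesis by simp
qed

lemma definable_disj:
  assumes "definable Q" "definable R"
  shows "definable (\<lambda>e. Q e \<or> R e)"
  by (rule definable_cong[OF definable_not[OF definable_conj[OF assms[THEN definable_not]]]]) auto

lemma definable_imp:
  assumes "definable Q" "definable R"
  shows "definable (\<lambda>e. Q e \<longrightarrow> R e)"
  by (rule definable_cong[OF definable_disj[OF definable_not[OF assms(1)] assms(2)]]) auto

lemma definable_iff:
  assumes "definable Q" "definable R"
  shows "definable (\<lambda>e. Q e \<longleftrightarrow> R e)"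
  by (rule definable_cong[OF definable_conj[OF definable_imp[OF assms] definable_imp[OF assms(2,1)]]]) auto

text \<open>The language has no function symbols, so a term is represented by its graph, with the
  value at index 0 and the arguments shifted up by one. Substitution of a term then becomes an
  existential quantifier over its value.\<close>

definition dterm :: "((nat \<Rightarrow> 'v) \<Rightarrow> 'v) \<Rightarrow> bool" where
  "dterm t \<longleftrightarrow> (\<forall>e. env e \<longrightarrow> t e \<in> W) \<and> definable (\<lambda>e. e 0 = t (\<lambda>n. e (Suc n)))"

lemma dterm_in: "dterm t \<Longrightarrow> env e \<Longrightarrow> t e \<in> W"
  unfolding dterm_def by blast

lemma dterm_var: "dterm (\<lambda>e. e i)"
  unfolding dterm_def by (auto intro: definable_eq_var)

lemma dterm_const: "c \<in> W \<Longrightarrow> dterm (\<lambda>e. c)"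
  unfolding dterm_def by (auto intro: definable_eq_const)

lemma env_shift: "env e \<Longrightarrow> env (\<lambda>n. e (Suc n))"
  by auto

lemma dtermI:
  assumes "definable (\<lambda>e. R (e 0) (\<lambda>n. e (Suc n)))"
    and "\<And>e. env e \<Longrightarrow> t e \<in> W"
    and "\<And>x e. x \<in> W \<Longrightarrow> env e \<Longrightarrow> x = t e \<longleftrightarrow> R x e"
  shows "dterm t"
  unfolding dterm_def
proof (intro conjI allI impI assms(2))
  show "definable (\<lambda>e. e 0 = t (\<lambda>n. e (Suc n)))"
    by (rule definable_cong[OF assms(1)]) (simp add: assms(3) env_app env_shift)
qed

lemma dterm_shift:
  assumes "dterm t"
  shows "dterm (\<lambda>e. t (\<lambda>n. e (Suc n)))"
proof -
  define f where "f n = (case n of 0 \<Rightarrow> 0 | Suc m \<Rightarrow> Suc (Suc m))" for n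
  have "inj f" unfolding f_def inj_def by (auto split: nat.splits)
  moreover have "definable (\<lambda>e. e 0 = t (\<lambda>n. e (Suc n)))"
    using assms unfolding dterm_def by blast
  ultimately have "definable (\<lambda>e. e (f 0) = t (\<lambda>n. e (f (Suc n))))"
    by (rule definable_rename[rotated])
  then show ?thesis
    using assms unfolding dterm_def by (auto simp: f_def env_shift)
qed

lemma definable_subst:
  assumes "dterm t" "definable (\<lambda>e. Q (e 0) (\<lambda>n. e (Suc n)))"
  shows "definable (\<lambda>e. Q (t e) e)"
proof -
  have "definable (\<lambda>e. \<exists>x\<in>W. x = t e \<and> Q x e)"
    using assms unfolding dterm_def by (intro definable_ex definable_conj) auto
  then show ?thesis
    by (rule definable_cong) (use assms(1) in \<open>auto simp: dterm_def\<close>)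
qed

lemma definable_eq:
  assumes "dterm t" "dterm s"
  shows "definable (\<lambda>e. t e = s e)"
  by (rule definable_subst[OF assms(1), of "\<lambda>x e. x = s e"])
    (use assms(2) in \<open>auto simp: dterm_def\<close>)

lemma definable_mem:
  assumes "dterm t" "dterm s"
  shows "definable (\<lambda>e. t e \<in> elts (s e))"
proof -
  have "definable (\<lambda>e. e (Suc 0) \<in> elts (e 0))" by (rule definable_mem_var)
  then have "definable (\<lambda>e. e 0 \<in> elts (s (\<lambda>n. e (Suc n))))"
    using definable_subst[OF dterm_shift[OF assms(2)], of "\<lambda>x e. e 0 \<in> elts x"] by simp
  then show ?thesis by (rule definable_subst[OF assms(1)])
qed

lemma definable_ball:
  assumes "dterm t" "definable (\<lambda>e. Q (e 0) (\<lambda>n. e (Suc n)))"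
  shows "definable (\<lambda>e. \<forall>x\<in>elts (t e). Q x e)"
proof -
  have "definable (\<lambda>e. \<forall>x\<in>W. x \<in> elts (t e) \<longrightarrow> Q x e)"
    by (intro definable_all definable_imp definable_mem dterm_var dterm_shift[OF assms(1)] assms)
  then show ?thesis
    by (rule definable_cong) (use assms(1) dterm_in elts_in in blast)
qed

lemma definable_bex:
  assumes "dterm t" "definable (\<lambda>e. Q (e 0) (\<lambda>n. e (Suc n)))"
  shows "definable (\<lambda>e. \<exists>x\<in>elts (t e). Q x e)"
proof -
  have "definable (\<lambda>e. \<not> (\<forall>x\<in>elts (t e). \<not> Q x e))"
    by (intro definable_not definable_ball assms)
  then show ?thesis by simp
qed

lemmas def_basic =
  definable_not definable_conj definable_disj definable_imp definable_iff
  definable_all definable_ex definable_ball definable_bex definable_eq definable_mem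
  dterm_var dterm_const

lemma definable_subset:
  assumes "dterm t" "dterm s"
  shows "definable (\<lambda>e. elts (t e) \<subseteq> elts (s e))"
  unfolding subset_eq by (intro def_basic assms dterm_shift[OF assms(2)])

lemma definable_elts_eq_insert:
  assumes "dterm t" "dterm a" "dterm b"
  shows "definable (\<lambda>e. elts (t e) = {a e, b e})"
proof -
  have "definable (\<lambda>e. (\<forall>x\<in>elts (t e). x = a e \<or> x = b e) \<and> a e \<in> elts (t e) \<and> b e \<in> elts (t e))"
    by (intro def_basic assms dterm_shift[OF assms(2)] dterm_shift[OF assms(3)])
  then show ?thesis by (rule definable_cong) auto
qed

section \<open>Set operations in the model\<close>

definition is_set :: "'v set \<Rightarrow> bool" where
  "is_set A \<longleftrightarrow> (\<exists>u\<in>W. elts u = A)"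

lemma is_setI: "u \<in> W \<Longrightarrow> elts u = A \<Longrightarrow> is_set A"
  unfolding is_set_def by auto

lemma is_set_elts: "x \<in> W \<Longrightarrow> is_set (elts x)"
  unfolding is_set_def by auto

lemma is_set_the_set: "is_set A \<Longrightarrow> the_set A \<in> W"
  unfolding is_set_def using the_set_eq by metis

lemma elts_the_set: "is_set A \<Longrightarrow> elts (the_set A) = A"
  unfolding is_set_def using the_set_eq by metis

lemma is_set_subset: "is_set A \<Longrightarrow> A \<subseteq> W"
  unfolding is_set_def using elts_in by blast

lemma dterm_the_set:
  assumes "definable (\<lambda>e. Q (e 0) (\<lambda>n. e (Suc n)))" "\<And>e. env e \<Longrightarrow> is_set {z \<in> W. Q z e}"
  shows "dterm (\<lambda>e. the_set {z \<in> W. Q z e})"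
proof (rule dtermI)
  define f where "f n = (case n of 0 \<Rightarrow> 0 | Suc m \<Rightarrow> Suc (Suc m))" for n
  have "inj f" unfolding f_def inj_def by (auto split: nat.splits)
  from definable_rename[OF assms(1) this]
  show "definable (\<lambda>e. \<forall>z\<in>W. z \<in> elts (e 0) \<longleftrightarrow> Q z (\<lambda>n. e (Suc n)))"
    by (intro def_basic) (simp add: f_def)
  show "the_set {z \<in> W. Q z e} \<in> W" if "env e" for e
    using assms(2)[OF that] by (rule is_set_the_set)
  show "x = the_set {z \<in> W. Q z e} \<longleftrightarrow> (\<forall>z\<in>W. z \<in> elts x \<longleftrightarrow> Q z e)" if "x \<in> W" "env e" for x e
  proof -
    have "x = the_set {z \<in> W. Q z e} \<longleftrightarrow> elts x = {z \<in> W. Q z e}"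
      using elts_the_set[OF assms(2)[OF that(2)]] by (metis elts_inject)
    then show ?thesis using elts_in[OF that(1)] by auto
  qed
qed

text \<open>Parameters of \<open>Q\<close> other than the displayed variable enter as constants and
  are absorbed by the sequence hidden in \<open>definable\<close>.\<close>

lemma is_set_sep:
  assumes "a \<in> W" "definable (\<lambda>e. Q (e 0))"
  shows "is_set {x \<in> elts a. Q x}"
proof -
  obtain \<phi> c where c: "env c" and \<phi>: "\<And>e. env e \<Longrightarrow> Q (e 0) \<longleftrightarrow> sat W (merge e c) \<phi>"
    using assms(2) unfolding definable_def by blast
  have "Separation_schema W" using zfc unfolding ZFC_model_def by blast
  moreover have "env (merge (\<lambda>_. a) c)" using c assms(1) by (auto simp: merge_def)
  ultimately obtain u where u: "u \<in> W"
    and *: "\<And>z. z \<in> W \<Longrightarrow> z \<in> elts u \<longleftrightarrow> z \<in> elts a \<and> sat W ((merge (\<lambda>_. a) c)(0 := z)) \<phi>"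
    unfolding Separation_schema_def elem_iff using assms(1) by meson
  have "sat W ((merge (\<lambda>_. a) c)(0 := z)) \<phi> \<longleftrightarrow> Q z" if "z \<in> W" for z
  proof -
    have "(merge (\<lambda>_. a) c)(0 := z) = merge ((\<lambda>_. a)(0 := z)) c"
      by (auto simp: merge_def fun_eq_iff elim!: evenE)
    then show ?thesis using \<phi>[of "(\<lambda>_. a)(0 := z)"] that assms(1) by auto
  qed
  then have "elts u = {x \<in> elts a. Q x}"
    using * elts_in[OF u] elts_in[OF assms(1)] by auto
  with u show ?thesis unfolding is_set_def by blast
qed

text \<open>Only the relation \<open>R\<close> has to be definable; \<open>F\<close> may be any HOL
  function that \<open>R\<close> describes on a. This admits functions chosen by
  \<open>SOME\<close>, as long as \<open>R\<close> makes their values unique.\<close>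

lemma is_set_image:
  assumes "a \<in> W" "definable (\<lambda>e. R (e 0) (e (Suc 0)))"
    and in_W: "\<And>x. x \<in> elts a \<Longrightarrow> F x \<in> W"
    and R: "\<And>x y. x \<in> elts a \<Longrightarrow> y \<in> W \<Longrightarrow> R x y \<longleftrightarrow> y = F x"
  shows "is_set (F ` elts a)"
proof -
  obtain \<phi> c where c: "env c"
    and \<phi>: "\<And>e. env e \<Longrightarrow> R (e 0) (e (Suc 0)) \<longleftrightarrow> sat W (merge e c) \<phi>"
    using assms(2) unfolding definable_def by blast
  \<comment> \<open>The Replacement schema displays the variables 0 and 1, whereas
    \<open>merge\<close> puts the two free variables at 0 and 2. Position 2 is therefore sent to 1
    and everything else is moved out of the way by two places.\<close>
  define f where "f n = (if n = 0 then 0 else if n = 2 then 1 else n + 2)" for n :: nat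
  have f: "inj f" unfolding f_def inj_def by (auto split: if_splits)
  define e where "e n = merge (\<lambda>_. a) c (n - 2)" for n
  have e: "env e" using c assms(1) by (auto simp: merge_def e_def)
  have *: "sat W (e(0 := x, 1 := y)) (ren f \<phi>) \<longleftrightarrow> R x y" if "x \<in> W" "y \<in> W" for x y
  proof -
    have "e(0 := x, 1 := y) \<circ> f = merge ((\<lambda>_. a)(0 := x, 1 := y)) c"
      by (auto simp: merge_def e_def f_def fun_eq_iff elim!: evenE)
    then show ?thesis
      using \<phi>[of "(\<lambda>_. a)(0 := x, 1 := y)"] that assms(1) by (auto simp: sat_ren[OF f])
  qed
  have repl: "Replacement_schema W" using zfc unfolding ZFC_model_def by blast
  have "\<exists>!y. y \<in> W \<and> sat W (e(0 := x, 1 := y)) (ren f \<phi>)" if "x \<in> W" "x \<in> elts a" for x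
    using that * R in_W by metis
  then obtain u where u: "u \<in> W"
    and **: "\<And>y. y \<in> W \<Longrightarrow> y \<in> elts u \<longleftrightarrow>
      (\<exists>x\<in>W. x \<in> elts a \<and> sat W (e(0 := x, 1 := y)) (ren f \<phi>))"
    using repl[unfolded Replacement_schema_def elem_iff, rule_format, OF e assms(1), of "ren f \<phi>"]
    by auto
  have "y \<in> elts u \<longleftrightarrow> y \<in> F ` elts a" for y
  proof (cases "y \<in> W")
    case True
    then have "y \<in> elts u \<longleftrightarrow> (\<exists>x\<in>elts a. R x y)"
      using ** * elts_in[OF assms(1)] by metis
    also have "\<dots> \<longleftrightarrow> y \<in> F ` elts a" using R True by auto
    finally show ?thesis .
  qed (use in_W elts_in[OF u] in auto)
  then have "elts u = F ` elts a" by blast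
  with u show ?thesis unfolding is_set_def by blast
qed

lemma is_set_doubleton:
  assumes "x \<in> W" "y \<in> W"
  shows "is_set {x, y}"
proof -
  have ax: "Pairing_ax W" using zfc unfolding ZFC_model_def by blast
  obtain u where u: "u \<in> W" "\<forall>z\<in>W. z \<in> elts u \<longleftrightarrow> z = x \<or> z = y"
    by (rule bexE[OF ax[unfolded Pairing_ax_def elem_iff, rule_format, OF assms]])
  show ?thesis
  proof (rule is_setI[OF u(1)], rule set_eqI)
    show "z \<in> elts u \<longleftrightarrow> z \<in> {x, y}" for z
      using u(2) elts_in[OF u(1)] assms by (cases "z \<in> W") auto
  qed
qed

lemma is_set_Union:
  assumes "x \<in> W"
  shows "is_set (\<Union>y\<in>elts x. elts y)"
proof -
  have ax: "Union_ax W" using zfc unfolding ZFC_model_def by blast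
  obtain u where u: "u \<in> W" "\<forall>z\<in>W. z \<in> elts u \<longleftrightarrow> (\<exists>y\<in>W. y \<in> elts x \<and> z \<in> elts y)"
    by (rule bexE[OF ax[unfolded Union_ax_def elem_iff, rule_format, OF assms]])
  show ?thesis
  proof (rule is_setI[OF u(1)], rule set_eqI)
    show "z \<in> elts u \<longleftrightarrow> z \<in> (\<Union>y\<in>elts x. elts y)" for z
    proof (cases "z \<in> W")
      case True
      then show ?thesis using u(2) elts_in[OF assms] by auto
    next
      case False
      then show ?thesis using elts_in[OF u(1)] elts_in[OF elts_in[OF assms]] by auto
    qed
  qed
qed

lemma is_set_Pow:
  assumes "x \<in> W"
  shows "is_set {z \<in> W. elts z \<subseteq> elts x}"
proof -
  have ax: "Power_set_ax W" using zfc unfolding ZFC_model_def by blast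
  obtain u where u: "u \<in> W" "\<forall>z\<in>W. z \<in> elts u \<longleftrightarrow> (\<forall>w\<in>W. w \<in> elts z \<longrightarrow> w \<in> elts x)"
    by (rule bexE[OF ax[unfolded Power_set_ax_def elem_iff, rule_format, OF assms]])
  show ?thesis
  proof (rule is_setI[OF u(1)], rule set_eqI)
    show "z \<in> elts u \<longleftrightarrow> z \<in> {z \<in> W. elts z \<subseteq> elts x}" for z
      using u(2) elts_in[OF u(1), of z] elts_in[of z] by (cases "z \<in> W") auto
  qed
qed

lemma is_set_Un: "is_set A \<Longrightarrow> is_set B \<Longrightarrow> is_set (A \<union> B)"
proof -
  assume "is_set A" "is_set B"
  then obtain a b where ab: "a \<in> W" "b \<in> W" "elts a = A" "elts b = B"
    unfolding is_set_def by blast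
  obtain u where "u \<in> W" "elts u = {a, b}"
    using is_set_doubleton[OF ab(1,2)] unfolding is_set_def by blast
  then show ?thesis using is_set_Union[of u] ab by simp
qed

lemma is_set_insert: "x \<in> W \<Longrightarrow> is_set A \<Longrightarrow> is_set (insert x A)"
  using is_set_Un[OF is_set_doubleton[of x x]] by simp

lemma is_pair_pair: "x \<in> W \<Longrightarrow> y \<in> W \<Longrightarrow> is_pair (pair x y) x y"
  and pair_in: "x \<in> W \<Longrightarrow> y \<in> W \<Longrightarrow> pair x y \<in> W"
proof -
  assume xy: "x \<in> W" "y \<in> W"
  obtain a where a: "a \<in> W" "elts a = {x, x}"
    using is_set_doubleton[OF xy(1,1)] unfolding is_set_def by blast
  obtain b where b: "b \<in> W" "elts b = {x, y}"
    using is_set_doubleton[OF xy] unfolding is_set_def by blast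
  obtain z where z: "z \<in> W" "elts z = {a, b}"
    using is_set_doubleton[OF a(1) b(1)] unfolding is_set_def by blast
  have "is_pair z x y" unfolding is_pair_def using a b z by auto
  then show "is_pair (pair x y) x y" "pair x y \<in> W" using z pair_eq by auto
qed

lemma is_pair_iff: "x \<in> W \<Longrightarrow> y \<in> W \<Longrightarrow> is_pair z x y \<longleftrightarrow> z = pair x y"
  using is_pair_pair pair_eq by blast

lemma pair_inject:
  "x \<in> W \<Longrightarrow> y \<in> W \<Longrightarrow> x' \<in> W \<Longrightarrow> y' \<in> W \<Longrightarrow> pair x y = pair x' y' \<longleftrightarrow> x = x' \<and> y = y'"
  using is_pair_pair is_pair_inject by metis

lemma is_pair_in: "z \<in> W \<Longrightarrow> is_pair z x y \<Longrightarrow> x \<in> W \<and> y \<in> W"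
  unfolding is_pair_def using elts_in by (metis insertCI)

lemma rel_of_in: "r \<in> W \<Longrightarrow> (x, y) \<in> rel_of r \<Longrightarrow> x \<in> W \<and> y \<in> W"
  unfolding rel_of_def elem_iff using is_pair_in elts_in by blast

lemma rel_of_iff: "x \<in> W \<Longrightarrow> y \<in> W \<Longrightarrow> (x, y) \<in> rel_of r \<longleftrightarrow> pair x y \<in> elts r"
  unfolding rel_of_def elem_iff using is_pair_iff by auto

lemma dterm_pair:
  assumes "dterm a" "dterm b"
  shows "dterm (\<lambda>e. pair (a e) (b e))"
proof (rule dtermI[where R = "\<lambda>x e. \<exists>u\<in>W. \<exists>v\<in>W. elts x = {u, v} \<and>
    elts u = {a e, a e} \<and> elts v = {a e, b e}"])
  show "definable (\<lambda>e. \<exists>u\<in>W. \<exists>v\<in>W. elts (e 0) = {u, v} \<and>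
      elts u = {a (\<lambda>n. e (Suc n)), a (\<lambda>n. e (Suc n))} \<and>
      elts v = {a (\<lambda>n. e (Suc n)), b (\<lambda>n. e (Suc n))})"
    by (intro def_basic definable_elts_eq_insert
        dterm_shift[OF dterm_shift[OF dterm_shift[OF assms(1)]]]
        dterm_shift[OF dterm_shift[OF dterm_shift[OF assms(2)]]])
  show "pair (a e) (b e) \<in> W" if "env e" for e
    using assms that by (simp add: pair_in dterm_in)
  show "x = pair (a e) (b e) \<longleftrightarrow> (\<exists>u\<in>W. \<exists>v\<in>W. elts x = {u, v} \<and>
      elts u = {a e, a e} \<and> elts v = {a e, b e})" if "x \<in> W" "env e" for x e
  proof -
    have in_W: "u \<in> W \<and> v \<in> W" if "elts x = {u, v}" for u v
      using that elts_in[OF \<open>x \<in> W\<close>] by simp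
    have "x = pair (a e) (b e) \<longleftrightarrow> is_pair x (a e) (b e)"
      using is_pair_iff assms that(2) by (simp add: dterm_in)
    also have "\<dots> \<longleftrightarrow> (\<exists>u v. elts x = {u, v} \<and> elts u = {a e, a e} \<and> elts v = {a e, b e})"
      unfolding is_pair_def insert_absorb2 by (rule refl)
    also have "\<dots> \<longleftrightarrow> (\<exists>u\<in>W. \<exists>v\<in>W. elts x = {u, v} \<and>
      elts u = {a e, a e} \<and> elts v = {a e, b e})"
      unfolding Bex_def using in_W by (intro ex_cong1) metis
    finally show ?thesis .
  qed
qed

lemma definable_rel_of:
  assumes "dterm a" "dterm b" "dterm r"
  shows "definable (\<lambda>e. (a e, b e) \<in> rel_of (r e))"
proof -
  have "definable (\<lambda>e. pair (a e) (b e) \<in> elts (r e))"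
    by (intro def_basic dterm_pair assms)
  then show ?thesis by (rule definable_cong) (simp add: rel_of_iff dterm_in assms)
qed

lemmas def_intros = def_basic definable_subset dterm_pair definable_rel_of

definition product :: "'v \<Rightarrow> 'v \<Rightarrow> 'v" where
  "product a b = the_set {z \<in> W. \<exists>x\<in>elts a. \<exists>y\<in>elts b. z = pair x y}"

text \<open>Replacement produces each row \<open>{pair x y | x \<in> a}\<close>, a second
  Replacement collects the rows, and Union joins them.\<close>

lemma is_set_product:
  assumes "a \<in> W" "b \<in> W"
  shows "is_set {z \<in> W. \<exists>x\<in>elts a. \<exists>y\<in>elts b. z = pair x y}"
proof -
  define F where "F y = the_set ((\<lambda>x. pair x y) ` elts a)" for y
  have F: "is_set ((\<lambda>x. pair x y) ` elts a)" if "y \<in> W" for y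
    by (rule is_set_image[OF assms(1), of "\<lambda>x z. z = pair x y"])
      (use that elts_in[OF assms(1)] in \<open>auto intro!: def_intros pair_in\<close>)
  have "is_set (F ` elts b)"
  proof (rule is_set_image[OF assms(2), where R = "\<lambda>y u. \<forall>z\<in>W. z \<in> elts u \<longleftrightarrow> (\<exists>x\<in>elts a. z = pair x y)"])
    show "definable (\<lambda>e. \<forall>z\<in>W. z \<in> elts (e (Suc 0)) \<longleftrightarrow> (\<exists>x\<in>elts a. z = pair x (e 0)))"
      by (intro def_intros assms)
    show F_in: "F y \<in> W" if "y \<in> elts b" for y
      unfolding F_def by (intro is_set_the_set F elts_in[OF assms(2) that])
    show "(\<forall>z\<in>W. z \<in> elts u \<longleftrightarrow> (\<exists>x\<in>elts a. z = pair x y)) \<longleftrightarrow> u = F y"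
      if "y \<in> elts b" "u \<in> W" for y u
    proof -
      have y: "y \<in> W" using that elts_in[OF assms(2)] by simp
      have "u = F y \<longleftrightarrow> elts u = (\<lambda>x. pair x y) ` elts a"
        unfolding F_def using elts_the_set[OF F[OF y]] by (metis elts_inject)
      moreover have "(\<lambda>x. pair x y) ` elts a \<subseteq> W" using F[OF y] by (rule is_set_subset)
      ultimately show ?thesis using elts_in[OF that(2)] by (auto simp: set_eq_iff)
    qed
  qed
  then obtain s where s: "s \<in> W" "elts s = F ` elts b" unfolding is_set_def by blast
  have "is_set (\<Union>y\<in>elts s. elts y)" by (rule is_set_Union[OF s(1)])
  moreover have "elts (F y) = (\<lambda>x. pair x y) ` elts a" if "y \<in> elts b" for y
    unfolding F_def by (intro elts_the_set F elts_in[OF assms(2) that])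
  then have "(\<Union>y\<in>elts s. elts y) = {z \<in> W. \<exists>x\<in>elts a. \<exists>y\<in>elts b. z = pair x y}"
    using s(2) elts_in[OF assms(1)] elts_in[OF assms(2)] pair_in by auto
  ultimately show ?thesis by simp
qed

lemma product_in: "a \<in> W \<Longrightarrow> b \<in> W \<Longrightarrow> product a b \<in> W"
  unfolding product_def using is_set_product is_set_the_set by blast

lemma elts_product:
  assumes "a \<in> W" "b \<in> W"
  shows "elts (product a b) = {pair x y |x y. x \<in> elts a \<and> y \<in> elts b}"
  unfolding product_def elts_the_set[OF is_set_product[OF assms]]
  using elts_in[OF assms(1)] elts_in[OF assms(2)] pair_in by auto

lemma pair_in_product:
  assumes "a \<in> W" "b \<in> W" "x \<in> W" "y \<in> W"
  shows "pair x y \<in> elts (product a b) \<longleftrightarrow> x \<in> elts a \<and> y \<in> elts b"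
  unfolding elts_product[OF assms(1,2)]
  using assms elts_in[OF assms(1)] elts_in[OF assms(2)] pair_inject by auto

section \<open>Substitution into predicates and functions of one or two variables\<close>

lemma definable_unary:
  assumes "definable (\<lambda>e. Q (e 0))" "dterm a"
  shows "definable (\<lambda>e. Q (a e))"
  by (rule definable_subst[OF assms(2), of "\<lambda>x e. Q x"]) (rule assms(1))

lemma definable_binary:
  assumes "definable (\<lambda>e. Q (e 0) (e (Suc 0)))" "dterm a" "dterm b"
  shows "definable (\<lambda>e. Q (a e) (b e))"
proof (rule definable_subst[OF assms(2), of "\<lambda>x e. Q x (b e)"])
  define f where "f n = (if n = 0 then 1 else if n = 1 then 0 else n)" for n :: nat
  have "inj f" unfolding f_def inj_def by auto
  from definable_rename[OF assms(1) this]
  have "definable (\<lambda>e. Q (e (Suc 0)) (e 0))" by (simp add: f_def)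
  then show "definable (\<lambda>e. Q (e 0) (b (\<lambda>n. e (Suc n))))"
    by (rule definable_subst[OF dterm_shift[OF assms(3)], of "\<lambda>x e. Q (e 0) x"])
qed

lemma dterm_unary:
  assumes "dterm (\<lambda>e. F (e 0))" "dterm a"
  shows "dterm (\<lambda>e. F (a e))"
  unfolding dterm_def
proof (intro conjI allI impI)
  have F: "definable (\<lambda>e. e 0 = F (e (Suc 0)))" using assms(1) unfolding dterm_def by blast
  show "definable (\<lambda>e. e 0 = F (a (\<lambda>n. e (Suc n))))"
    by (rule definable_binary[OF F dterm_var dterm_shift[OF assms(2)]])
  show "F (a e) \<in> W" if "env e" for e
    using dterm_in[OF assms(1), of "\<lambda>_. a e"] dterm_in[OF assms(2) that] by auto
qed

lemma dterm_binary:
  assumes "dterm (\<lambda>e. F (e 0) (e (Suc 0)))" "dterm a" "dterm b"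
  shows "dterm (\<lambda>e. F (a e) (b e))"
  unfolding dterm_def
proof (intro conjI allI impI)
  define f where "f n = (if n = 0 then 2 else if n = 2 then 0 else n)" for n :: nat
  have f: "inj f" unfolding f_def inj_def by auto
  have "definable (\<lambda>e. e 0 = F (e (Suc 0)) (e (Suc (Suc 0))))"
    using assms(1) unfolding dterm_def by blast
  from definable_rename[OF this f]
  have "definable (\<lambda>e. e (Suc (Suc 0)) = F (e (Suc 0)) (e 0))"
    by (simp add: f_def numeral_2_eq_2)
  then have "definable (\<lambda>e. e (Suc 0) = F (e 0) (b (\<lambda>n. e (Suc (Suc n)))))"
    by (rule definable_subst[OF dterm_shift[OF dterm_shift[OF assms(3)]],
          of "\<lambda>x e. e (Suc 0) = F (e 0) x"])
  then show "definable (\<lambda>e. e 0 = F (a (\<lambda>n. e (Suc n))) (b (\<lambda>n. e (Suc n))))"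
    by (rule definable_subst[OF dterm_shift[OF assms(2)],
          of "\<lambda>x e. e 0 = F x (b (\<lambda>n. e (Suc n)))"])
  show "F (a e) (b e) \<in> W" if "env e" for e
    using dterm_in[OF assms(1), of "case_nat (a e) (\<lambda>_. b e)"]
      dterm_in[OF assms(2) that] dterm_in[OF assms(3) that] by (force split: nat.splits)
qed

section \<open>Recursion in the model\<close>

text \<open>The transitive closure of x, without x itself, characterized by minimality among the
  sets of \<open>W\<close>. In this form it is definable by a single formula, before recursion is
  available.\<close>

definition is_closure :: "'v \<Rightarrow> 'v \<Rightarrow> bool" where
  "is_closure x t \<longleftrightarrow> elts x \<subseteq> elts t \<and> (\<forall>y\<in>elts t. elts y \<subseteq> elts t) \<and>
     (\<forall>t'\<in>W. elts x \<subseteq> elts t' \<and> (\<forall>y\<in>elts t'. elts y \<subseteq> elts t') \<longrightarrow> elts t \<subseteq> elts t')"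

lemma is_closure_unique: "is_closure x t \<Longrightarrow> is_closure x t' \<Longrightarrow> t \<in> W \<Longrightarrow> t' \<in> W \<Longrightarrow> t = t'"
  unfolding is_closure_def elts_inject[symmetric] by (meson subset_antisym)

lemma definable_is_closure: "definable (\<lambda>e. is_closure (e 0) (e (Suc 0)))"
  unfolding is_closure_def by (intro def_intros)

text \<open>The closure of x is the union of x and the closures of its elements. These are collected
  by Replacement, which applies because closures are unique and definable.\<close>

lemma ex_closure: "x \<in> W \<Longrightarrow> \<exists>t\<in>W. is_closure x t"
proof (induction x rule: elem_induct)
  case (step x)
  define F where "F y = (SOME t. t \<in> W \<and> is_closure y t)" for y
  have F: "F y \<in> W \<and> is_closure y (F y)" if "y \<in> elts x" for y
    unfolding F_def by (rule someI_ex) (use step that elts_in in blast)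
  have "is_set (F ` elts x)"
    by (rule is_set_image[OF step(2) definable_is_closure])
      (use F is_closure_unique in blast)+
  then obtain s where s: "s \<in> W" "elts s = F ` elts x" unfolding is_set_def by auto
  have "is_set (elts x \<union> (\<Union>y\<in>elts s. elts y))"
    by (intro is_set_Un is_set_elts is_set_Union s step)
  then obtain t where t: "t \<in> W" "elts t = elts x \<union> (\<Union>y\<in>elts x. elts (F y))"
    unfolding is_set_def using s by auto
  have "is_closure x t"
    unfolding is_closure_def
  proof (intro conjI ballI impI)
    fix y assume "y \<in> elts t"
    then consider "y \<in> elts x" | z where "z \<in> elts x" "y \<in> elts (F z)" using t by auto
    then show "elts y \<subseteq> elts t"
    proof cases
      case 1
      then have "elts y \<subseteq> elts (F y)" using F is_closure_def by blast
      then show ?thesis using 1 t by auto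
    next
      case 2
      then have "elts y \<subseteq> elts (F z)" using F is_closure_def by blast
      then show ?thesis using 2 t by auto
    qed
  next
    fix t' assume t': "t' \<in> W" "elts x \<subseteq> elts t' \<and> (\<forall>y\<in>elts t'. elts y \<subseteq> elts t')"
    have "elts (F y) \<subseteq> elts t'" if "y \<in> elts x" for y
    proof -
      have "elts y \<subseteq> elts t'" using t' that by blast
      then show ?thesis using F[OF that] t' unfolding is_closure_def by blast
    qed
    then show "elts t \<subseteq> elts t'" using t' t by auto
  qed (use t in auto)
  with t show ?case by blast
qed

text \<open>The recursion is carried out in HOL along the ambient membership relation; what follows
  shows that for definable \<open>G\<close> it maps \<open>W\<close> into \<open>W\<close>
  definably. The step function receives only the set of earlier values, which suffices for ranks,
  canonical names and the choice process.\<close>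

definition recursion :: "('v \<Rightarrow> 'v \<Rightarrow> 'v) \<Rightarrow> 'v \<Rightarrow> 'v" where
  "recursion G = wfrec {(x, y). x \<^bold>\<in> y} (\<lambda>f x. G x (the_set (f ` elts x)))"

lemma recursion_eq: "recursion G x = G x (the_set (recursion G ` elts x))"
proof -
  have "cut (recursion G) {(x, y). x \<^bold>\<in> y} x ` elts x = recursion G ` elts x"
    by (auto simp: cut_def elts_def)
  then show ?thesis
    unfolding recursion_def by (subst wfrec[OF elem_wf]) simp
qed

text \<open>A set of argument-value pairs whose domain is closed under elements and whose values
  obey the recursion, s being the set of values at the elements of y. That f is a function is not
  demanded but follows from \<open>approximation_eq\<close>.\<close>

definition approximation :: "('v \<Rightarrow> 'v \<Rightarrow> 'v) \<Rightarrow> 'v \<Rightarrow> bool" where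
  "approximation G f \<longleftrightarrow> (\<forall>z\<in>elts f. \<exists>y\<in>W. \<exists>v\<in>W. z = pair y v \<and>
     (\<forall>y'\<in>elts y. \<exists>v'\<in>W. pair y' v' \<in> elts f) \<and>
     (\<exists>s\<in>W. (\<forall>v'\<in>W. v' \<in> elts s \<longleftrightarrow> (\<exists>y'\<in>elts y. pair y' v' \<in> elts f)) \<and> v = G y s))"

lemma approximationD:
  assumes "approximation G f" "pair y v \<in> elts f" "y \<in> W" "v \<in> W"
  shows "\<forall>y'\<in>elts y. \<exists>v'\<in>W. pair y' v' \<in> elts f"
    and "\<exists>s\<in>W. (\<forall>v'\<in>W. v' \<in> elts s \<longleftrightarrow> (\<exists>y'\<in>elts y. pair y' v' \<in> elts f)) \<and> v = G y s"
proof -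
  obtain y0 v0 where *: "y0 \<in> W" "v0 \<in> W" "pair y v = pair y0 v0"
    "\<forall>y'\<in>elts y0. \<exists>v'\<in>W. pair y' v' \<in> elts f"
    "\<exists>s\<in>W. (\<forall>v'\<in>W. v' \<in> elts s \<longleftrightarrow> (\<exists>y'\<in>elts y0. pair y' v' \<in> elts f)) \<and> v0 = G y0 s"
    using assms(1)[unfolded approximation_def, rule_format, OF assms(2)] by metis
  then have "y0 = y" "v0 = v" using pair_inject assms(3,4) by metis+
  then show "\<forall>y'\<in>elts y. \<exists>v'\<in>W. pair y' v' \<in> elts f"
    "\<exists>s\<in>W. (\<forall>v'\<in>W. v' \<in> elts s \<longleftrightarrow> (\<exists>y'\<in>elts y. pair y' v' \<in> elts f)) \<and> v = G y s"
    using * by auto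
qed

lemma approximation_eq:
  assumes "approximation G f"
  shows "pair y v \<in> elts f \<Longrightarrow> y \<in> W \<Longrightarrow> v \<in> W \<Longrightarrow> v = recursion G y"
proof (induction y arbitrary: v rule: elem_induct)
  case (step y)
  note D = approximationD[OF assms step(2-4)]
  obtain s where s: "s \<in> W" "\<forall>v'\<in>W. v' \<in> elts s \<longleftrightarrow> (\<exists>y'\<in>elts y. pair y' v' \<in> elts f)" "v = G y s"
    using D(2) by blast
  have IH: "v' = recursion G y'" if "y' \<in> elts y" "pair y' v' \<in> elts f" "v' \<in> W" for y' v'
    using step(1)[OF that(1,2)] elts_in[OF step(3) that(1)] that(3) by blast
  have "elts s = recursion G ` elts y"
  proof (intro set_eqI iffI)
    fix v' assume v': "v' \<in> elts s"
    then have "v' \<in> W" by (rule elts_in[OF s(1)])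
    then show "v' \<in> recursion G ` elts y" using s(2) v' IH by blast
  next
    fix v' assume "v' \<in> recursion G ` elts y"
    then obtain y' where y': "y' \<in> elts y" "v' = recursion G y'" by blast
    then obtain v'' where v'': "v'' \<in> W" "pair y' v'' \<in> elts f" using D(1) by blast
    then have "v'' = v'" using IH y' by blast
    then show "v' \<in> elts s" using s(2) v'' y'(1) by blast
  qed
  then have "the_set (recursion G ` elts y) = s" by (rule the_set_eq)
  then show ?case using s(3) recursion_eq[of G y] by simp
qed

lemma approximationI:
  assumes D: "\<And>z y. z \<in> D \<Longrightarrow> y \<in> elts z \<Longrightarrow> y \<in> D"
    and W: "\<And>z. z \<in> D \<Longrightarrow> z \<in> W \<and> recursion G z \<in> W \<and> is_set (recursion G ` elts z)"
    and f: "elts f = (\<lambda>z. pair z (recursion G z)) ` D"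
  shows "approximation G f"
  unfolding approximation_def
proof
  fix w assume "w \<in> elts f"
  then obtain z where z: "z \<in> D" "w = pair z (recursion G z)" using f by auto
  have in_f: "pair y v \<in> elts f \<longleftrightarrow> v = recursion G y" if "y \<in> elts z" "v \<in> W" for y v
  proof -
    have "y \<in> D" by (rule D[OF z(1) that(1)])
    then show ?thesis using W pair_inject that(2) unfolding f image_iff by metis
  qed
  show "\<exists>y\<in>W. \<exists>v\<in>W. w = pair y v \<and> (\<forall>y'\<in>elts y. \<exists>v'\<in>W. pair y' v' \<in> elts f) \<and>
    (\<exists>s\<in>W. (\<forall>v'\<in>W. v' \<in> elts s \<longleftrightarrow> (\<exists>y'\<in>elts y. pair y' v' \<in> elts f)) \<and> v = G y s)"
  proof (intro bexI conjI)
    show "w = pair z (recursion G z)" by (rule z)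
    show "\<forall>y'\<in>elts z. \<exists>v'\<in>W. pair y' v' \<in> elts f"
      using in_f W D[OF z(1)] by blast
    let ?s = "the_set (recursion G ` elts z)"
    have "elts ?s = recursion G ` elts z" using W[OF z(1)] by (simp add: elts_the_set)
    then show "\<forall>v'\<in>W. v' \<in> elts ?s \<longleftrightarrow> (\<exists>y'\<in>elts z. pair y' v' \<in> elts f)"
      using in_f by auto
    show "recursion G z = G z ?s" by (rule recursion_eq)
    show "?s \<in> W" using W[OF z(1)] is_set_the_set by blast
  qed (use W z in auto)
qed

context
  fixes G
  assumes G: "dterm (\<lambda>e. G (e 0) (e (Suc 0)))"
begin

lemma definable_approximation: "definable (\<lambda>e. approximation G (e 0))"
  unfolding approximation_def by (intro def_intros dterm_binary[OF G])

text \<open>The set s of those z in the closure t of x that receive a value from some approximation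
  contains the elements of x, by induction, and is transitive, since domains of approximations are
  closed under elements. Minimality of t gives that t is contained in s. Since all values agree with
  \<open>recursion G\<close>, Replacement yields one approximation with domain t together with x,
  without gluing the earlier ones.\<close>

lemma ex_approximation:
  "x \<in> W \<Longrightarrow> \<exists>f\<in>W. approximation G f \<and> (\<exists>v\<in>W. pair x v \<in> elts f)"
proof (induction x rule: elem_induct)
  case (step x)
  define R where "R z v \<longleftrightarrow> (\<exists>f\<in>W. approximation G f \<and> pair z v \<in> elts f)" for z v
  have R_def2: "definable (\<lambda>e. R (e 0) (e (Suc 0)))"
    unfolding R_def by (intro def_intros definable_unary[OF definable_approximation])
  obtain t where t: "t \<in> W" "is_closure x t" using ex_closure[OF step(2)] by blast
  have "is_set {z \<in> elts t. \<exists>v\<in>W. R z v}"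
    by (rule is_set_sep[OF t(1)]) (intro def_intros definable_binary[OF R_def2])
  then obtain s where s: "s \<in> W" "elts s = {z \<in> elts t. \<exists>v\<in>W. R z v}" unfolding is_set_def by auto
  have "elts x \<subseteq> elts s"
  proof
    fix y assume y: "y \<in> elts x"
    then have "\<exists>f\<in>W. approximation G f \<and> (\<exists>v\<in>W. pair y v \<in> elts f)"
      using step(1) elts_in[OF step(2)] by blast
    then show "y \<in> elts s" unfolding s R_def using y t(2) is_closure_def by blast
  qed
  moreover have "elts z \<subseteq> elts s" if z: "z \<in> elts s" for z
  proof
    fix y assume y: "y \<in> elts z"
    obtain v f where f: "v \<in> W" "f \<in> W" "approximation G f" "pair z v \<in> elts f"
      using z unfolding s R_def by blast
    have "z \<in> W" using elts_in[OF s(1) z] .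
    then have "\<exists>v\<in>W. pair y v \<in> elts f" using approximationD(1)[OF f(3,4)] f(1) y by blast
    moreover have "y \<in> elts t" using z y t(2) unfolding s is_closure_def by blast
    ultimately show "y \<in> elts s" unfolding s R_def using f by blast
  qed
  ultimately have ts: "elts t \<subseteq> elts s" using t(2) s(1) unfolding is_closure_def by blast
  have R: "R z v \<longleftrightarrow> v = recursion G z" and in_W: "recursion G z \<in> W" if "z \<in> elts t" "v \<in> W" for z v
  proof -
    have z: "z \<in> W" using elts_in[OF t(1) that(1)] .
    have 1: "v = recursion G z" if "R z v" "v \<in> W" for v
      using that approximation_eq z unfolding R_def by blast
    have "z \<in> elts s" using ts that(1) by (rule subsetD)
    then obtain v' where v': "v' \<in> W" "R z v'" unfolding s by blast
    then have "v' = recursion G z" using 1 by blast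
    then show "R z v \<longleftrightarrow> v = recursion G z" "recursion G z \<in> W" using 1 v' that(2) by auto
  qed
  note in_W = in_W[OF _ step(2)]
  have rec_set: "is_set (recursion G ` elts z)" if "z \<in> W" "elts z \<subseteq> elts t" for z
    by (rule is_set_image[OF that(1) R_def2]) (use that R in_W in blast)+
  have x_t: "elts x \<subseteq> elts t" and t_t: "\<And>y. y \<in> elts t \<Longrightarrow> elts y \<subseteq> elts t"
    using t(2) unfolding is_closure_def by blast+
  have rec_x: "recursion G x \<in> W"
  proof -
    have *: "is_set (recursion G ` elts x)" by (rule rec_set[OF step(2) x_t])
    have "G x (the_set (recursion G ` elts x)) \<in> W"
      using dterm_in[OF dterm_binary[OF G dterm_const[OF step(2)] dterm_const[OF is_set_the_set[OF *]]],
        of "\<lambda>_. x"] step(2) by auto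
    then show ?thesis using recursion_eq[of G x] by simp
  qed
  have "is_set ((\<lambda>z. pair z (recursion G z)) ` elts t)"
  proof (rule is_set_image[OF t(1), where R = "\<lambda>z w. \<exists>v\<in>W. w = pair z v \<and> R z v"])
    show "definable (\<lambda>e. \<exists>v\<in>W. e (Suc 0) = pair (e 0) v \<and> R (e 0) v)"
      by (intro def_intros definable_binary[OF R_def2])
  qed (use R in_W pair_in elts_in[OF t(1)] in auto)
  then have "is_set ((\<lambda>z. pair z (recursion G z)) ` (insert x (elts t)))"
    using is_set_insert[OF pair_in[OF step(2) rec_x]] by simp
  then obtain f where f: "f \<in> W" "elts f = (\<lambda>z. pair z (recursion G z)) ` (insert x (elts t))"
    unfolding is_set_def by auto
  have "approximation G f"
    by (rule approximationI[OF _ _ f(2)])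
      (use x_t t_t rec_x rec_set in_W t(1) step(2) elts_in[OF t(1)] in auto)
  with f rec_x show ?case by auto
qed

lemma recursion_in: "x \<in> W \<Longrightarrow> recursion G x \<in> W"
  using ex_approximation approximation_eq by blast

lemma recursion_iff:
  assumes "x \<in> W" "v \<in> W"
  shows "v = recursion G x \<longleftrightarrow> (\<exists>f\<in>W. approximation G f \<and> pair x v \<in> elts f)"
  using ex_approximation[OF assms(1)] approximation_eq assms by metis

lemma dterm_recursion: "dterm (\<lambda>e. recursion G (e 0))"
proof (rule dtermI[where R = "\<lambda>v e. \<exists>f\<in>W. approximation G f \<and> pair (e 0) v \<in> elts f"])
  show "definable (\<lambda>e. \<exists>f\<in>W. approximation G f \<and> pair (e (Suc 0)) (e 0) \<in> elts f)"
    by (intro def_intros definable_unary[OF definable_approximation])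
  show "recursion G (e 0) \<in> W" if "env e" for e
    by (rule recursion_in[OF env_app[OF that]])
  show "v = recursion G (e 0) \<longleftrightarrow> (\<exists>f\<in>W. approximation G f \<and> pair (e 0) v \<in> elts f)"
    if "v \<in> W" "env e" for v e
    by (rule recursion_iff[OF env_app[OF that(2)] that(1)])
qed

lemma is_set_recursion_image:
  assumes "x \<in> W"
  shows "is_set (recursion G ` elts x)"
proof (rule is_set_image[OF assms, where R = "\<lambda>x v. v = recursion G x"])
  show "definable (\<lambda>e. e (Suc 0) = recursion G (e 0))"
    by (intro def_intros dterm_unary[OF dterm_recursion])
qed (simp_all add: recursion_in elts_in[OF assms])

end

text \<open>The usual rank, the supremum of the successors of the ranks of the elements. Its purpose
  is to bound the ordinals denoted by names.\<close>

definition rank :: "'v \<Rightarrow> 'v" where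
  "rank = recursion (\<lambda>x s. the_set {z \<in> W. z \<in> elts s \<or> (\<exists>r\<in>elts s. z \<in> elts r)})"

lemma is_set_rank_step:
  assumes "s \<in> W"
  shows "is_set {z \<in> W. z \<in> elts s \<or> (\<exists>r\<in>elts s. z \<in> elts r)}"
proof -
  have "{z \<in> W. z \<in> elts s \<or> (\<exists>r\<in>elts s. z \<in> elts r)} = elts s \<union> (\<Union>r\<in>elts s. elts r)"
    using elts_in[OF assms] elts_in[OF elts_in[OF assms]] by auto
  then show ?thesis using is_set_Un[OF is_set_elts[OF assms] is_set_Union[OF assms]] by simp
qed

lemma dterm_rank_step:
  "dterm (\<lambda>e. (\<lambda>x s. the_set {z \<in> W. z \<in> elts s \<or> (\<exists>r\<in>elts s. z \<in> elts r)}) (e 0) (e (Suc 0)))"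
  by (rule dterm_the_set) (intro def_intros, simp add: is_set_rank_step env_app)

lemma rank_in: "x \<in> W \<Longrightarrow> rank x \<in> W"
  unfolding rank_def by (rule recursion_in[OF dterm_rank_step])

lemma elts_rank:
  assumes "x \<in> W"
  shows "elts (rank x) = rank ` elts x \<union> (\<Union>y\<in>elts x. elts (rank y))"
proof -
  let ?s = "the_set (rank ` elts x)"
  have s: "?s \<in> W" "elts ?s = rank ` elts x"
    using is_set_recursion_image[OF dterm_rank_step assms] is_set_the_set elts_the_set
    unfolding rank_def by blast+
  have "rank x = the_set {z \<in> W. z \<in> elts ?s \<or> (\<exists>r\<in>elts ?s. z \<in> elts r)}"
    unfolding rank_def by (rule recursion_eq)
  then have "elts (rank x) = {z \<in> W. z \<in> elts ?s \<or> (\<exists>r\<in>elts ?s. z \<in> elts r)}"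
    using elts_the_set[OF is_set_rank_step[OF s(1)]] by simp
  also have "\<dots> = elts ?s \<union> (\<Union>r\<in>elts ?s. elts r)"
    using elts_in[OF s(1)] elts_in[OF elts_in[OF s(1)]] by auto
  finally show ?thesis unfolding s(2) by simp
qed

lemma is_ordinal_rank: "x \<in> W \<Longrightarrow> is_ordinal (rank x)"
proof (induction x rule: elem_induct)
  case (step x)
  have IH: "is_ordinal (rank y)" if "y \<in> elts x" for y
    using step(1)[OF that elts_in[OF step(2) that]] .
  have 1: "is_ordinal z" if "z \<in> elts (rank x)" for z
    using that IH is_ordinal_elem unfolding elts_rank[OF step(2)] by auto
  have 2: "elts z \<subseteq> elts (rank x)" if z: "z \<in> elts (rank x)" for z
  proof -
    consider y where "y \<in> elts x" "z = rank y" | y where "y \<in> elts x" "z \<in> elts (rank y)"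
      using z unfolding elts_rank[OF step(2)] by auto
    then show ?thesis
    proof cases
      case 1
      then show ?thesis unfolding elts_rank[OF step(2)] by auto
    next
      case 2
      then have "elts z \<subseteq> elts (rank y)" using is_ordinal_trans[OF IH] by auto
      then show ?thesis using 2 unfolding elts_rank[OF step(2)] by auto
    qed
  qed
  show ?case
    unfolding is_ordinal_def
  proof (intro conjI ballI)
    fix y z assume "y \<in> elts (rank x)" "z \<in> elts y"
    then show "elts z \<subseteq> elts y" using 1 is_ordinal_trans by blast
  qed (rule 2)
qed

lemma rank_mono: "x \<in> W \<Longrightarrow> y \<in> elts x \<Longrightarrow> rank y \<in> elts (rank x)"
  using elts_rank by auto

section \<open>Canonical names of ground model sets\<close>

lemma dterm_product:
  "P \<in> W \<Longrightarrow> dterm (\<lambda>e. (\<lambda>x s. product s P) (e 0) (e (Suc 0)))"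
  unfolding product_def
  by (rule dterm_the_set) (intro def_intros, assumption, simp add: is_set_product env_app)

text \<open>A forcing notion here may lack a greatest condition, so each element is paired with
  every condition; nonemptiness of the filter then gives the right value.\<close>

definition check :: "'v \<Rightarrow> 'v \<Rightarrow> 'v" where
  "check P = recursion (\<lambda>x s. product s P)"

lemma dterm_check: "P \<in> W \<Longrightarrow> dterm (\<lambda>e. check P (e 0))"
  unfolding check_def by (rule dterm_recursion[OF dterm_product])

lemma check_in: "P \<in> W \<Longrightarrow> x \<in> W \<Longrightarrow> check P x \<in> W"
  unfolding check_def by (rule recursion_in[OF dterm_product])

lemma elts_check:
  assumes "P \<in> W" "x \<in> W"
  shows "elts (check P x) = {pair (check P y) p |y p. y \<in> elts x \<and> p \<in> elts P}"
proof -
  let ?s = "the_set (check P ` elts x)"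
  have s: "?s \<in> W" "elts ?s = check P ` elts x"
    using is_set_recursion_image[OF dterm_product[OF assms(1)] assms(2)] is_set_the_set elts_the_set
    unfolding check_def by blast+
  have "check P x = product ?s P"
    unfolding check_def by (rule recursion_eq)
  then show ?thesis using elts_product[OF s(1) assms(1)] s(2) by auto
qed

section \<open>Maximal cliques in the model\<close>

text \<open>\<open>Choice_ax\<close> gives a transversal of a family of disjoint sets. The sets
  \<open>B u\<close>, which tag the elements of u with u, are disjoint, and a transversal of them is
  the graph of a choice function on the nonempty subsets of \<open>S\<close>.\<close>

lemma choice_function:
  assumes S: "S \<in> W"
  obtains c where "c \<in> W"
    "\<And>u. u \<in> W \<Longrightarrow> elts u \<subseteq> elts S \<Longrightarrow> elts u \<noteq> {} \<Longrightarrow> \<exists>!v. v \<in> elts u \<and> pair u v \<in> elts c"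
proof -
  define B where "B u = the_set {z \<in> W. \<exists>v\<in>elts u. z = pair u v}" for u
  have B_set: "is_set {z \<in> W. \<exists>v\<in>elts u. z = pair u v}" if "u \<in> W" for u
  proof -
    have "is_set ((\<lambda>v. pair u v) ` elts u)"
    proof (rule is_set_image[OF that, where R = "\<lambda>v z. z = pair u v"])
      show "definable (\<lambda>e. e (Suc 0) = pair u (e 0))" by (intro def_intros that)
    qed (simp_all add: that pair_in elts_in[OF that])
    moreover have "(\<lambda>v. pair u v) ` elts u = {z \<in> W. \<exists>v\<in>elts u. z = pair u v}"
      using pair_in[OF that elts_in[OF that]] by auto
    ultimately show ?thesis by simp
  qed
  have B_in: "B u \<in> W" and elts_B: "elts (B u) = {pair u v |v. v \<in> elts u}" if "u \<in> W" for u
    unfolding B_def using is_set_the_set[OF B_set[OF that]] elts_the_set[OF B_set[OF that]]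
      pair_in[OF that elts_in[OF that]] by auto
  have dterm_B: "dterm (\<lambda>e. B (e 0))"
    unfolding B_def by (rule dterm_the_set) (intro def_intros, simp add: B_set env_app)
  obtain p where p: "p \<in> W" "elts p = {u \<in> W. elts u \<subseteq> elts S}"
    using is_set_Pow[OF S] unfolding is_set_def by auto
  have "is_set {u \<in> elts p. \<exists>v\<in>elts u. v = v}"
    by (rule is_set_sep[OF p(1)]) (intro def_intros)
  moreover have "{u \<in> elts p. \<exists>v\<in>elts u. v = v} = {u \<in> W. elts u \<subseteq> elts S \<and> elts u \<noteq> {}}"
    unfolding p(2) by auto
  ultimately obtain q where q: "q \<in> W" "elts q = {u \<in> W. elts u \<subseteq> elts S \<and> elts u \<noteq> {}}"
    unfolding is_set_def by auto
  have "is_set (B ` elts q)"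
  proof (rule is_set_image[OF q(1), where R = "\<lambda>u b. b = B u"])
    show "definable (\<lambda>e. e (Suc 0) = B (e 0))" by (intro def_intros dterm_unary[OF dterm_B])
  qed (simp_all add: B_in elts_in[OF q(1)])
  then obtain a where a: "a \<in> W" "elts a = B ` elts q" unfolding is_set_def by auto
  have ax: "Choice_ax W" using zfc unfolding ZFC_model_def by blast
  have a_elem: "\<exists>u. u \<in> W \<and> elts u \<noteq> {} \<and> x = B u \<and> elts x = {pair u v |v. v \<in> elts u}"
    if x: "x \<in> elts a" for x
  proof -
    obtain u where "u \<in> W" "elts u \<noteq> {}" "x = B u" using x unfolding a(2) q(2) by auto
    then show ?thesis by (intro exI[of _ u]) (simp add: elts_B)
  qed
  have "\<exists>c\<in>W. \<forall>x\<in>W. x \<in> elts a \<longrightarrow> (\<exists>!z. z \<in> W \<and> z \<in> elts x \<and> z \<in> elts c)"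
  proof (rule ax[unfolded Choice_ax_def elem_iff, rule_format, OF a(1)], intro conjI ballI impI)
    fix x assume "x \<in> W" "x \<in> elts a"
    then show "\<exists>z\<in>W. z \<in> elts x" using a_elem elts_in by blast
  next
    fix x y assume xy: "x \<in> W" "y \<in> W" "x \<in> elts a \<and> y \<in> elts a \<and> x \<noteq> y"
    obtain u where u: "u \<in> W" "x = B u" "elts x = {pair u v |v. v \<in> elts u}"
      using a_elem xy by blast
    obtain u' where u': "u' \<in> W" "y = B u'" "elts y = {pair u' v |v. v \<in> elts u'}"
      using a_elem xy by blast
    have "u \<noteq> u'" using xy u u' by auto
    show "\<not> (\<exists>z\<in>W. z \<in> elts x \<and> z \<in> elts y)"
    proof
      assume "\<exists>z\<in>W. z \<in> elts x \<and> z \<in> elts y"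
      then obtain v v' where v: "v \<in> elts u" "v' \<in> elts u'" "pair u v = pair u' v'"
        unfolding u(3) u'(3) by auto
      then have "u = u'" using pair_inject u(1) u'(1) elts_in[OF u(1)] elts_in[OF u'(1)] by blast
      with \<open>u \<noteq> u'\<close> show False ..
    qed
  qed
  then obtain c where c: "c \<in> W"
    "\<forall>x\<in>W. x \<in> elts a \<longrightarrow> (\<exists>!z. z \<in> W \<and> z \<in> elts x \<and> z \<in> elts c)" by blast
  show thesis
  proof (rule that[OF c(1)])
    fix u assume u: "u \<in> W" "elts u \<subseteq> elts S" "elts u \<noteq> {}"
    have "B u \<in> elts a" using u unfolding a(2) q(2) by auto
    then obtain z where z: "z \<in> elts (B u)" "z \<in> elts c"
      "\<And>z'. z' \<in> W \<Longrightarrow> z' \<in> elts (B u) \<Longrightarrow> z' \<in> elts c \<Longrightarrow> z' = z"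
      using c(2) B_in[OF u(1)] by metis
    then obtain v where v: "v \<in> elts u" "z = pair u v" unfolding elts_B[OF u(1)] by auto
    show "\<exists>!v. v \<in> elts u \<and> pair u v \<in> elts c"
    proof (rule ex1I[of _ v])
      show "v \<in> elts u \<and> pair u v \<in> elts c" using v z by simp
      fix v' assume v': "v' \<in> elts u \<and> pair u v' \<in> elts c"
      have "pair u v' \<in> W" using v' u elts_in pair_in by blast
      moreover have "pair u v' \<in> elts (B u)" using v' elts_B[OF u(1)] by auto
      ultimately have "pair u v' = pair u v" using z(3) v' v(2) by blast
      then show "v' = v" using pair_inject u(1) elts_in[OF u(1)] v v' by blast
    qed
  qed
qed

lemma definable_is_ordinal: "definable (\<lambda>e. is_ordinal (e 0))"
  unfolding is_ordinal_def by (intro def_intros)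

text \<open>The Burali-Forti argument: a set of all ordinals of \<open>W\<close> would be an ordinal
  of \<open>W\<close> and hence its own element.\<close>

lemma not_is_set_ordinals: "\<not> is_set {\<alpha> \<in> W. is_ordinal \<alpha>}"
proof
  assume "is_set {\<alpha> \<in> W. is_ordinal \<alpha>}"
  then obtain u where u: "u \<in> W" "elts u = {\<alpha> \<in> W. is_ordinal \<alpha>}" unfolding is_set_def by auto
  have "is_ordinal u"
    unfolding is_ordinal_def
  proof (intro conjI ballI)
    show "elts y \<subseteq> elts u" if "y \<in> elts u" for y
      using that is_ordinal_elem elts_in unfolding u(2) by blast
    show "elts z \<subseteq> elts y" if "y \<in> elts u" "z \<in> elts y" for y z
      using that is_ordinal_trans unfolding u(2) by blast
  qed
  then have "u \<in> elts u" using u by simp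
  then show False by simp
qed

text \<open>Elements are chosen along the ordinals; the process stops because otherwise the ordinals of \<open>W\<close>
  would inject into \<open>S\<close>.  The value \<open>S \<notin> S\<close> marks the stages after that.\<close>

lemma ex_maximal_clique:
  assumes S: "S \<in> W" and Q: "definable (\<lambda>e. Q (e 0) (e (Suc 0)))"
    and sym: "\<And>x y. Q x y \<Longrightarrow> Q y x"
  obtains V where "V \<in> W" "elts V \<subseteq> elts S"
    "\<And>x y. x \<in> elts V \<Longrightarrow> y \<in> elts V \<Longrightarrow> x \<noteq> y \<Longrightarrow> Q x y"
    "\<And>x. x \<in> elts S \<Longrightarrow> x \<in> elts V \<or> (\<exists>y\<in>elts V. \<not> Q x y)"
proof -
  obtain c where c: "c \<in> W" and choice: "\<And>u. u \<in> W \<Longrightarrow> elts u \<subseteq> elts S \<Longrightarrow> elts u \<noteq> {} \<Longrightarrow>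
      \<exists>!v. v \<in> elts u \<and> pair u v \<in> elts c"
    using choice_function[OF S] by blast
  define E where "E A = {x \<in> elts S. x \<notin> A \<and> (\<forall>v\<in>A. Q x v)}" for A
  define G where "G x s = (if E (elts s) = {} then S
    else THE v. v \<in> E (elts s) \<and> pair (the_set (E (elts s))) v \<in> elts c)" for x s :: 'v
  have E_set: "is_set (E (elts s))" if "s \<in> W" for s
    unfolding E_def
    by (rule is_set_sep[OF S]) (intro def_intros definable_binary[OF Q] that)
  have G_choice: "G x s \<in> E (elts s) \<and> pair (the_set (E (elts s))) (G x s) \<in> elts c \<and>
      (\<forall>v. v \<in> E (elts s) \<and> pair (the_set (E (elts s))) v \<in> elts c \<longrightarrow> v = G x s)"
    if "s \<in> W" "E (elts s) \<noteq> {}" for x s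
  proof -
    have ex1: "\<exists>!v. v \<in> E (elts s) \<and> pair (the_set (E (elts s))) v \<in> elts c"
      using choice[of "the_set (E (elts s))"] that E_set[OF that(1)]
      by (auto simp: is_set_the_set elts_the_set E_def)
    have G: "G x s = (THE v. v \<in> E (elts s) \<and> pair (the_set (E (elts s))) v \<in> elts c)"
      using that(2) by (simp add: G_def)
    show ?thesis unfolding G using theI'[OF ex1] ex1 by blast
  qed
  have G_in: "G x s \<in> W" if "s \<in> W" for x s
  proof (cases "E (elts s) = {}")
    case True
    then show ?thesis using S by (simp add: G_def)
  next
    case False
    then have "G x s \<in> elts S" using G_choice that unfolding E_def by blast
    then show ?thesis by (rule elts_in[OF S])
  qed
  have G_term: "dterm (\<lambda>e. G (e 0) (e (Suc 0)))"
  \<comment> \<open>Here u is the set of remaining candidates, \<open>E (elts s)\<close> with s the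
    second argument. The clause \<open>\<forall>x\<in>elts u. x \<noteq> x\<close> says that u is
    empty, in a shape that the definability rules accept.\<close>
  proof (rule dtermI[where R = "\<lambda>v e. \<exists>u\<in>W. (\<forall>x\<in>W. x \<in> elts u \<longleftrightarrow>
      x \<in> elts S \<and> x \<notin> elts (e (Suc 0)) \<and> (\<forall>w\<in>elts (e (Suc 0)). Q x w)) \<and>
      ((\<forall>x\<in>elts u. x \<noteq> x) \<and> v = S \<or> v \<in> elts u \<and> pair u v \<in> elts c)"])
    show "definable (\<lambda>e. \<exists>u\<in>W. (\<forall>x\<in>W. x \<in> elts u \<longleftrightarrow>
      x \<in> elts S \<and> x \<notin> elts (e (Suc (Suc 0))) \<and> (\<forall>w\<in>elts (e (Suc (Suc 0))). Q x w)) \<and>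
      ((\<forall>x\<in>elts u. x \<noteq> x) \<and> e 0 = S \<or> e 0 \<in> elts u \<and> pair u (e 0) \<in> elts c))"
      by (intro def_intros definable_binary[OF Q] S c)
    show "G (e 0) (e (Suc 0)) \<in> W" if "env e" for e
      by (rule G_in[OF env_app[OF that]])
    show "v = G (e 0) (e (Suc 0)) \<longleftrightarrow> (\<exists>u\<in>W. (\<forall>x\<in>W. x \<in> elts u \<longleftrightarrow>
      x \<in> elts S \<and> x \<notin> elts (e (Suc 0)) \<and> (\<forall>w\<in>elts (e (Suc 0)). Q x w)) \<and>
      ((\<forall>x\<in>elts u. x \<noteq> x) \<and> v = S \<or> v \<in> elts u \<and> pair u v \<in> elts c))"
      if "v \<in> W" "env e" for v e
    proof -
      define s where "s = e (Suc 0)"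
      have s: "s \<in> W" using that(2) unfolding s_def by (rule env_app)
      let ?u = "the_set (E (elts s))"
      have u: "?u \<in> W" "elts ?u = E (elts s)"
        using is_set_the_set elts_the_set E_set[OF s] by blast+
      have u_iff: "(\<forall>x\<in>W. x \<in> elts u \<longleftrightarrow> x \<in> elts S \<and> x \<notin> elts s \<and> (\<forall>w\<in>elts s. Q x w)) \<longleftrightarrow> u = ?u"
        if "u \<in> W" for u
      proof -
        have "u = ?u \<longleftrightarrow> elts u = E (elts s)" using u(2) by (metis elts_inject)
        then show ?thesis
          unfolding E_def set_eq_iff using elts_in[OF that] elts_in[OF S] by auto
      qed
      have "(\<exists>u\<in>W. (\<forall>x\<in>W. x \<in> elts u \<longleftrightarrow> x \<in> elts S \<and> x \<notin> elts s \<and> (\<forall>w\<in>elts s. Q x w)) \<and>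
        ((\<forall>x\<in>elts u. x \<noteq> x) \<and> v = S \<or> v \<in> elts u \<and> pair u v \<in> elts c)) \<longleftrightarrow>
        (E (elts s) = {} \<and> v = S \<or> v \<in> E (elts s) \<and> pair ?u v \<in> elts c)"
        using u u_iff by auto
      also have "\<dots> \<longleftrightarrow> v = G (e 0) s"
      proof (cases "E (elts s) = {}")
        case True
        then show ?thesis by (simp add: G_def)
      next
        case False
        then show ?thesis using G_choice[OF s False, of "e 0"] by auto
      qed
      finally show ?thesis unfolding s_def by simp
    qed
  qed
  define F where "F = recursion G"
  define I where "I \<alpha> = E (F ` elts \<alpha>)" for \<alpha>
  have F_img: "is_set (F ` elts x)" if "x \<in> W" for x
    unfolding F_def by (rule is_set_recursion_image[OF G_term that])
  have F_I: "F x \<in> I x" if "x \<in> W" "I x \<noteq> {}" for x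
  proof -
    have "F x = G x (the_set (F ` elts x))" unfolding F_def by (rule recursion_eq)
    then show ?thesis
      using G_choice[of "the_set (F ` elts x)" x] that elts_the_set[OF F_img] is_set_the_set[OF F_img]
      unfolding I_def by auto
  qed
  have "\<exists>\<alpha>. \<alpha> \<in> W \<and> is_ordinal \<alpha> \<and> I \<alpha> = {}"
  proof (rule ccontr)
    assume "\<not> ?thesis"
    then have F: "F \<alpha> \<in> elts S \<and> F \<alpha> \<notin> F ` elts \<alpha>" if "\<alpha> \<in> W" "is_ordinal \<alpha>" for \<alpha>
      using that F_I[OF that(1)] unfolding I_def E_def by blast
    have F_inj: "\<alpha> = \<beta>" if "\<alpha> \<in> W" "is_ordinal \<alpha>" "\<beta> \<in> W" "is_ordinal \<beta>" "F \<alpha> = F \<beta>" for \<alpha> \<beta>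
      using is_ordinal_linear[OF that(2,4)] F[OF that(1,2)] F[OF that(3,4)] that(5) by (metis imageI)
    have "is_set {x \<in> elts S. \<exists>\<alpha>\<in>W. is_ordinal \<alpha> \<and> x = F \<alpha>}"
      by (rule is_set_sep[OF S], unfold F_def)
        (intro def_intros definable_unary[OF definable_is_ordinal]
          dterm_unary[OF dterm_recursion[OF G_term]])
    then obtain s where s: "s \<in> W" "elts s = {x \<in> elts S. \<exists>\<alpha>\<in>W. is_ordinal \<alpha> \<and> x = F \<alpha>}"
      unfolding is_set_def by auto
    \<comment> \<open>As \<open>F\<close> is injective on the ordinals, its inverse is given by a
      definable relation, and Replacement would turn the set s of values into the class of all
      ordinals of \<open>W\<close>.\<close>
    define H where "H x = (SOME \<alpha>. \<alpha> \<in> W \<and> is_ordinal \<alpha> \<and> x = F \<alpha>)" for x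
    have H: "H x \<in> W \<and> is_ordinal (H x) \<and> x = F (H x)" if "x \<in> elts s" for x
      unfolding H_def by (rule someI_ex) (use that s in auto)
    have "is_set (H ` elts s)"
    proof (rule is_set_image[OF s(1), where R = "\<lambda>x \<alpha>. is_ordinal \<alpha> \<and> x = F \<alpha>"])
      show "definable (\<lambda>e. is_ordinal (e (Suc 0)) \<and> e 0 = F (e (Suc 0)))"
        unfolding F_def by (intro def_intros definable_unary[OF definable_is_ordinal]
          dterm_unary[OF dterm_recursion[OF G_term]])
      show "H x \<in> W" if "x \<in> elts s" for x using H[OF that] by simp
      show "is_ordinal \<alpha> \<and> x = F \<alpha> \<longleftrightarrow> \<alpha> = H x" if "x \<in> elts s" "\<alpha> \<in> W" for x \<alpha>
        using H[OF that(1)] that(2) F_inj by metis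
    qed
    moreover have "\<alpha> \<in> H ` elts s" if "\<alpha> \<in> W" "is_ordinal \<alpha>" for \<alpha>
    proof -
      have Fs: "F \<alpha> \<in> elts s" using F[OF that] that unfolding s(2) by auto
      then have "\<alpha> = H (F \<alpha>)" using H[OF Fs] F_inj that by metis
      then show ?thesis using Fs by (rule image_eqI)
    qed
    then have "H ` elts s = {\<alpha> \<in> W. is_ordinal \<alpha>}" using H by auto
    ultimately show False using not_is_set_ordinals by simp
  qed
  \<comment> \<open>At the least stage \<alpha> without candidates, every earlier value is a genuine
    candidate and not the marker \<open>S\<close>, so the values below \<alpha> form a clique in
    \<open>S\<close>; the lack of candidates at \<alpha> is its maximality.\<close>
  then obtain \<alpha>0 where "\<alpha>0 \<in> {\<alpha> \<in> W. is_ordinal \<alpha> \<and> I \<alpha> = {}}" by auto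
  then obtain \<alpha> where \<alpha>: "\<alpha> \<in> W" "is_ordinal \<alpha>" "I \<alpha> = {}"
    and min: "\<And>\<beta>. \<beta> \<in> elts \<alpha> \<Longrightarrow> \<beta> \<notin> {\<alpha> \<in> W. is_ordinal \<alpha> \<and> I \<alpha> = {}}"
    by (rule wfE_min[OF elem_wf]) (auto simp: elem_iff)
  have FI: "F \<beta> \<in> I \<beta>" if "\<beta> \<in> elts \<alpha>" for \<beta>
    using F_I min[OF that] that elts_in[OF \<alpha>(1) that] is_ordinal_elem[OF \<alpha>(2) that] by blast
  obtain V where V: "V \<in> W" "elts V = F ` elts \<alpha>" using F_img[OF \<alpha>(1)] unfolding is_set_def by auto
  show thesis
  proof (rule that[OF V(1)])
    show "elts V \<subseteq> elts S" using FI unfolding V(2) I_def E_def by auto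
    show "Q x y" if xy: "x \<in> elts V" "y \<in> elts V" "x \<noteq> y" for x y
    proof -
      obtain \<beta> \<gamma> where \<beta>: "\<beta> \<in> elts \<alpha>" "x = F \<beta>" and \<gamma>: "\<gamma> \<in> elts \<alpha>" "y = F \<gamma>"
        using xy unfolding V(2) by auto
      then consider "\<beta> \<in> elts \<gamma>" | "\<gamma> \<in> elts \<beta>"
        using is_ordinal_linear is_ordinal_elem[OF \<alpha>(2)] xy(3) by blast
      then show ?thesis
      proof cases
        case 1
        then show ?thesis using FI[OF \<gamma>(1)] \<beta> \<gamma> unfolding I_def E_def by (auto intro: sym)
      next
        case 2
        then show ?thesis using FI[OF \<beta>(1)] \<beta> \<gamma> unfolding I_def E_def by auto
      qed
    qed
    show "x \<in> elts V \<or> (\<exists>y\<in>elts V. \<not> Q x y)" if "x \<in> elts S" for x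
      using that \<alpha>(3) unfolding V(2) I_def E_def by blast
  qed
qed

end

section \<open>Sets in the generic extension\<close>

locale generic_ext = transitive_zfc W for W :: "'v::set_universe set" +
  fixes P leq :: 'v and T WT :: "'v set" and val :: "'v \<Rightarrow> 'v"
  assumes P_in: "P \<in> W" and leq_in: "leq \<in> W"
    and notion: "forcing_notion P leq"
    and generic: "generic_filter W P leq T"
    and val: "\<forall>\<tau>\<in>W. P_name P \<tau> \<longrightarrow>
      elts (val \<tau>) = {val \<sigma> | \<sigma> p. p \<in> T \<and> (\<sigma>, p) \<in> rel_of \<tau>}"
    and WT: "WT = val ` {\<tau> \<in> W. P_name P \<tau>}"
begin

abbreviation le :: "'v \<Rightarrow> 'v \<Rightarrow> bool" where
  "le p q \<equiv> (p, q) \<in> rel_of leq"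

lemma le_refl: "p \<in> elts P \<Longrightarrow> le p p"
  using notion unfolding forcing_notion_def preorder_on_def refl_on_def by blast

lemma le_trans: "le p q \<Longrightarrow> le q r \<Longrightarrow> le p r"
  using notion unfolding forcing_notion_def preorder_on_def trans_def by blast

lemma T_subset: "p \<in> T \<Longrightarrow> p \<in> elts P"
  using generic unfolding generic_filter_def is_filter_def by blast

lemma T_nonempty: "\<exists>p. p \<in> T"
  using generic unfolding generic_filter_def is_filter_def by blast

lemma T_upward: "p \<in> T \<Longrightarrow> le p q \<Longrightarrow> q \<in> elts P \<Longrightarrow> q \<in> T"
  using generic unfolding generic_filter_def is_filter_def by blast

lemma T_directed: "p \<in> T \<Longrightarrow> q \<in> T \<Longrightarrow> \<exists>r\<in>T. le r p \<and> le r q"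
  using generic unfolding generic_filter_def is_filter_def by blast

lemma P_elt: "p \<in> elts P \<Longrightarrow> p \<in> W"
  by (rule elts_in[OF P_in])

lemmas force_intros = def_intros P_in leq_in

text \<open>Genericity in the form used throughout. Adding the conditions incompatible with p makes
  the set dense everywhere, and a member of \<open>T\<close> cannot be incompatible with p.\<close>

lemma generic_below:
  assumes Q: "definable (\<lambda>e. Q (e 0))" and p: "p \<in> T"
    and dense: "\<And>q. q \<in> elts P \<Longrightarrow> le q p \<Longrightarrow> \<exists>r\<in>elts P. le r q \<and> Q r"
  shows "\<exists>q\<in>T. Q q"
proof -
  have pW: "p \<in> W" by (rule P_elt[OF T_subset[OF p]])
  have "is_set {q \<in> elts P. Q q \<or> \<not> (\<exists>r\<in>elts P. le r p \<and> le r q)}"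
    by (rule is_set_sep[OF P_in]) (intro force_intros Q pW)
  then obtain D where D: "D \<in> W" "elts D = {q \<in> elts P. Q q \<or> \<not> (\<exists>r\<in>elts P. le r p \<and> le r q)}"
    unfolding is_set_def by auto
  have "dense_in P leq D"
    unfolding dense_in_def
  proof (intro conjI ballI)
    show "elts D \<subseteq> elts P" unfolding D(2) by auto
    fix q assume q: "q \<in> elts P"
    show "\<exists>r\<in>elts D. le r q"
    proof (cases "\<exists>r\<in>elts P. le r p \<and> le r q")
      case True
      then obtain r where r: "r \<in> elts P" "le r p" "le r q" by blast
      then obtain r' where "r' \<in> elts P" "le r' r" "Q r'" using dense by blast
      then show ?thesis using r le_trans unfolding D(2) by blast
    next
      case False
      then show ?thesis using q le_refl unfolding D(2) by blast
    qed
  qed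
  then obtain q where q: "q \<in> T" "q \<in> elts D"
    using generic D(1) unfolding generic_filter_def by blast
  have "\<exists>r\<in>elts P. le r p \<and> le r q" using T_directed[OF p q(1)] T_subset by blast
  then have "Q q" using q(2) unfolding D(2) by blast
  with q(1) show ?thesis by blast
qed

section \<open>Names, their values and the ordinals of the extension\<close>

definition name :: "'v \<Rightarrow> bool" where
  "name \<tau> \<longleftrightarrow> \<tau> \<in> W \<and> P_name P \<tau>"

lemma elts_val: "name \<tau> \<Longrightarrow> elts (val \<tau>) = {val \<sigma> | \<sigma> p. p \<in> T \<and> (\<sigma>, p) \<in> rel_of \<tau>}"
  using val unfolding name_def by blast

lemma WT_iff: "y \<in> WT \<longleftrightarrow> (\<exists>\<tau>. name \<tau> \<and> y = val \<tau>)"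
  unfolding WT name_def by blast

lemma name_elem:
  assumes "name \<tau>" "(\<sigma>, p) \<in> rel_of \<tau>"
  shows "name \<sigma>" "p \<in> elts P"
proof -
  obtain z where z: "z \<in> elts \<tau>" "is_pair z \<sigma> p" using assms(2) unfolding rel_of_def elem_iff by blast
  have "P_name P \<tau>" using assms(1) unfolding name_def by blast
  then obtain \<sigma>' p' where *: "is_pair z \<sigma>' p'" "p' \<in> elts P" "P_name P \<sigma>'"
    using z(1) unfolding elem_iff by (cases rule: P_name.cases) (auto simp: elem_iff)
  then have "\<sigma>' = \<sigma>" "p' = p" using is_pair_inject z(2) by blast+
  moreover have "\<sigma> \<in> W" using rel_of_in assms unfolding name_def by blast
  ultimately show "name \<sigma>" "p \<in> elts P" using * unfolding name_def by auto
qed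

lemma nameI:
  assumes "\<tau> \<in> W" "\<And>z. z \<in> elts \<tau> \<Longrightarrow> \<exists>\<sigma> p. z = pair \<sigma> p \<and> name \<sigma> \<and> p \<in> elts P"
  shows "name \<tau>"
proof -
  have "\<exists>\<sigma> p. is_pair z \<sigma> p \<and> p \<^bold>\<in> P \<and> P_name P \<sigma>" if "z \<in> elts \<tau>" for z
    using assms(2)[OF that] P_elt is_pair_pair unfolding name_def elem_iff by blast
  then show ?thesis using assms(1) P_name.intros unfolding name_def by blast
qed

lemma name_induct [consumes 1, case_names name]:
  assumes "name \<tau>"
    and "\<And>\<tau>. name \<tau> \<Longrightarrow> (\<And>\<sigma> p. (\<sigma>, p) \<in> rel_of \<tau> \<Longrightarrow> Q \<sigma>) \<Longrightarrow> Q \<tau>"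
  shows "Q \<tau>"
proof -
  have "P_name P \<tau>" "\<tau> \<in> W" using assms(1) unfolding name_def by auto
  then show ?thesis
  proof (induction \<tau> rule: P_name.induct)
    case (1 \<tau>)
    then have n: "name \<tau>" unfolding name_def using P_name.intros by blast
    have "Q \<sigma>" if \<sigma>: "(\<sigma>, p) \<in> rel_of \<tau>" for \<sigma> p
    proof -
      obtain z where z: "z \<in> elts \<tau>" "is_pair z \<sigma> p" using \<sigma> unfolding rel_of_def elem_iff by blast
      then obtain \<sigma>' p' where *: "is_pair z \<sigma>' p'" "\<sigma>' \<in> W \<longrightarrow> Q \<sigma>'" using 1(1) by blast
      then have "\<sigma>' = \<sigma>" using is_pair_inject z(2) by blast
      moreover have "\<sigma> \<in> W" using name_elem[OF n \<sigma>] unfolding name_def by blast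
      ultimately show ?thesis using * by blast
    qed
    then show ?case using assms(2)[OF n] by blast
  qed
qed

lemma name_check: "x \<in> W \<Longrightarrow> name (check P x)"
proof (induction x rule: elem_induct)
  case (step x)
  show ?case
  proof (rule nameI[OF check_in[OF P_in step(2)]])
    show "\<exists>\<sigma> p. z = pair \<sigma> p \<and> name \<sigma> \<and> p \<in> elts P" if "z \<in> elts (check P x)" for z
      using that step(1) elts_in[OF step(2)] unfolding elts_check[OF P_in step(2)] by blast
  qed
qed

lemma val_check: "x \<in> W \<Longrightarrow> val (check P x) = x"
proof (induction x rule: elem_induct)
  case (step x)
  have rel: "(\<sigma>, p) \<in> rel_of (check P x) \<longleftrightarrow> (\<exists>y\<in>elts x. \<sigma> = check P y) \<and> p \<in> elts P"
    if "\<sigma> \<in> W" "p \<in> W" for \<sigma> p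
    unfolding rel_of_iff[OF that] elts_check[OF P_in step(2)]
    using that pair_inject check_in[OF P_in] elts_in[OF step(2)] P_elt by auto
  note n = name_check[OF step(2)]
  have in_W: "\<sigma> \<in> W \<and> p \<in> W" if "(\<sigma>, p) \<in> rel_of (check P x)" for \<sigma> p
    by (rule rel_of_in[OF check_in[OF P_in step(2)] that])
  have "elts (val (check P x)) = (\<lambda>y. val (check P y)) ` elts x"
  proof (intro set_eqI iffI)
    fix v assume "v \<in> elts (val (check P x))"
    then show "v \<in> (\<lambda>y. val (check P y)) ` elts x"
      unfolding elts_val[OF n] using rel in_W by blast
  next
    fix v assume "v \<in> (\<lambda>y. val (check P y)) ` elts x"
    then obtain y where y: "y \<in> elts x" "v = val (check P y)" by blast
    obtain p where p: "p \<in> T" using T_nonempty by blast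
    have "(check P y, p) \<in> rel_of (check P x)"
      using rel[OF check_in[OF P_in elts_in[OF step(2) y(1)]] P_elt[OF T_subset[OF p]]] y(1)
        T_subset[OF p] by blast
    then show "v \<in> elts (val (check P x))" unfolding elts_val[OF n] using p y(2) by blast
  qed
  also have "\<dots> = elts x" using step(1) elts_in[OF step(2)] by simp
  finally show ?case by simp
qed

text \<open>Subsets of ground model sets in the extension are coded by relations \<open>U\<close> between
  conditions and elements.\<close>

definition realization :: "'v \<Rightarrow> 'v set" where
  "realization U = {x. \<exists>p\<in>T. (p, x) \<in> rel_of U}"

text \<open>The name consists of the pairs \<open>pair (check P x) p\<close> with (p, x) in
  \<open>U\<close>. This is how sets are put into the extension without using its axioms.\<close>

lemma ex_realization:
  assumes U: "U \<in> W"
  shows "\<exists>y\<in>WT. elts y = realization U"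
proof -
  define R where "R z w \<longleftrightarrow> (\<exists>p\<in>elts P. \<exists>x\<in>W. z = pair p x \<and> w = pair (check P x) p)" for z w
  have "is_set {z \<in> elts U. \<exists>p\<in>elts P. \<exists>x\<in>W. z = pair p x}"
    by (rule is_set_sep[OF U]) (intro force_intros)
  then obtain V where V: "V \<in> W" "elts V = {z \<in> elts U. \<exists>p\<in>elts P. \<exists>x\<in>W. z = pair p x}"
    unfolding is_set_def by auto
  define F where "F z = (SOME w. w \<in> W \<and> R z w)" for z
  have R_fun: "w = w'" if "R z w" "R z w'" for z w w'
    using that pair_inject P_elt unfolding R_def by metis
  have F: "F z \<in> W \<and> R z (F z)" if z: "z \<in> elts V" for z
  proof -
    obtain p x where px: "p \<in> elts P" "x \<in> W" "z = pair p x" using z unfolding V(2) by blast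
    then have "pair (check P x) p \<in> W \<and> R z (pair (check P x) p)"
      unfolding R_def using pair_in check_in[OF P_in] P_elt by blast
    then show ?thesis unfolding F_def by (rule someI)
  qed
  have "is_set (F ` elts V)"
  proof (rule is_set_image[OF V(1), where R = R])
    show "definable (\<lambda>e. R (e 0) (e (Suc 0)))"
      unfolding R_def by (intro force_intros dterm_unary[OF dterm_check[OF P_in]])
    show "F z \<in> W" if "z \<in> elts V" for z using F[OF that] by simp
    show "R z w \<longleftrightarrow> w = F z" if "z \<in> elts V" for z w
      using F[OF that] R_fun by metis
  qed
  then obtain \<tau> where \<tau>: "\<tau> \<in> W" "elts \<tau> = F ` elts V" unfolding is_set_def by auto
  have elts_\<tau>: "w \<in> elts \<tau> \<longleftrightarrow> (\<exists>p\<in>elts P. \<exists>x\<in>W. (p, x) \<in> rel_of U \<and> w = pair (check P x) p)" for w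
  proof
    assume "w \<in> elts \<tau>"
    then obtain z where z: "z \<in> elts V" "w = F z" unfolding \<tau>(2) by blast
    then obtain p x where "p \<in> elts P" "x \<in> W" "z = pair p x" "w = pair (check P x) p"
      using F[OF z(1)] unfolding R_def by blast
    then show "\<exists>p\<in>elts P. \<exists>x\<in>W. (p, x) \<in> rel_of U \<and> w = pair (check P x) p"
      using z(1) rel_of_iff P_elt unfolding V(2) by blast
  next
    assume "\<exists>p\<in>elts P. \<exists>x\<in>W. (p, x) \<in> rel_of U \<and> w = pair (check P x) p"
    then obtain p x where px: "p \<in> elts P" "x \<in> W" "(p, x) \<in> rel_of U" "w = pair (check P x) p"
      by blast
    then have z: "pair p x \<in> elts V" unfolding V(2) using rel_of_iff P_elt by blast
    have "R (pair p x) w" unfolding R_def using px by blast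
    then have "w = F (pair p x)" using F[OF z] R_fun by blast
    then show "w \<in> elts \<tau>" unfolding \<tau>(2) using z by blast
  qed
  have n: "name \<tau>"
    by (rule nameI[OF \<tau>(1)]) (use elts_\<tau> name_check in blast)
  have "elts (val \<tau>) = realization U"
  proof (intro set_eqI iffI)
    fix v assume "v \<in> elts (val \<tau>)"
    then obtain \<sigma> p where \<sigma>: "p \<in> T" "(\<sigma>, p) \<in> rel_of \<tau>" "v = val \<sigma>" unfolding elts_val[OF n] by blast
    have in_W: "\<sigma> \<in> W" "p \<in> W" using rel_of_in[OF \<tau>(1) \<sigma>(2)] by auto
    then have "pair \<sigma> p \<in> elts \<tau>" using \<sigma>(2) rel_of_iff by blast
    then obtain p' x where px: "p' \<in> elts P" "x \<in> W" "(p', x) \<in> rel_of U" "pair \<sigma> p = pair (check P x) p'"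
      unfolding elts_\<tau> by blast
    then have "\<sigma> = check P x" "p = p'" using pair_inject in_W check_in[OF P_in] P_elt by metis+
    then have "v = x" using \<sigma>(3) val_check[OF px(2)] by simp
    then show "v \<in> realization U"
      unfolding realization_def using px(3) \<sigma>(1) \<open>p = p'\<close> by blast
  next
    fix v assume "v \<in> realization U"
    then obtain p where p: "p \<in> T" "(p, v) \<in> rel_of U" unfolding realization_def by blast
    have v: "v \<in> W" using rel_of_in[OF U p(2)] by blast
    have "pair (check P v) p \<in> elts \<tau>" unfolding elts_\<tau> using p v T_subset by blast
    then have "(check P v, p) \<in> rel_of \<tau>"
      using rel_of_iff check_in[OF P_in v] P_elt[OF T_subset[OF p(1)]] by blast
    then have "val (check P v) \<in> elts (val \<tau>)" unfolding elts_val[OF n] using p(1) by blast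
    then show "v \<in> elts (val \<tau>)" using val_check[OF v] by simp
  qed
  then show ?thesis using n WT_iff by blast
qed

lemma rank_rel_of:
  assumes "\<tau> \<in> W" "(\<sigma>, p) \<in> rel_of \<tau>"
  shows "rank \<sigma> \<in> elts (rank \<tau>)"
proof -
  obtain z a where z: "z \<in> elts \<tau>" "a \<in> elts z" "\<sigma> \<in> elts a"
    using assms(2) unfolding rel_of_def elem_iff is_pair_def by auto
  have W: "z \<in> W" "a \<in> W" using elts_in assms(1) z by blast+
  have "rank \<sigma> \<in> elts (rank a)" "rank a \<in> elts (rank z)" "rank z \<in> elts (rank \<tau>)"
    using rank_mono assms(1) W z by auto
  then show ?thesis using is_ordinal_trans is_ordinal_rank assms(1) W by metis
qed

text \<open>By induction on names, an ordinal denoted by \<tau> is at most the rank of \<tau>, which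
  is an ordinal of the transitive class \<open>W\<close>.\<close>

lemma ordinal_in_ground:
  assumes "\<alpha> \<in> WT" "is_ordinal \<alpha>"
  shows "\<alpha> \<in> W"
proof -
  have *: "ord_le (val \<tau>) (rank \<tau>)" if "name \<tau>" "is_ordinal (val \<tau>)" for \<tau>
    using that
  proof (induction \<tau> rule: name_induct)
    case (name \<tau>)
    have \<tau>: "\<tau> \<in> W" using name(1) unfolding name_def by blast
    have "v \<in> elts (rank \<tau>)" if v: "v \<in> elts (val \<tau>)" for v
    proof -
      obtain \<sigma> p where \<sigma>: "(\<sigma>, p) \<in> rel_of \<tau>" "v = val \<sigma>" using v unfolding elts_val[OF name(1)] by blast
      have "ord_le v (rank \<sigma>)"
        using name(2)[OF \<sigma>(1)] is_ordinal_elem[OF name(3) v] \<sigma>(2) by simp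
      moreover have "rank \<sigma> \<in> elts (rank \<tau>)" by (rule rank_rel_of[OF \<tau> \<sigma>(1)])
      ultimately show ?thesis
        using is_ordinal_trans[OF is_ordinal_rank[OF \<tau>]] unfolding ord_le_def elem_iff by blast
    qed
    then have "elts (val \<tau>) \<subseteq> elts (rank \<tau>)" by blast
    then show ?case
      using is_ordinal_subset[OF name(3) is_ordinal_rank[OF \<tau>]] unfolding ord_le_def elem_iff by blast
  qed
  obtain \<tau> where \<tau>: "name \<tau>" "\<alpha> = val \<tau>" using assms(1) WT_iff by blast
  then have "ord_le \<alpha> (rank \<tau>)" "rank \<tau> \<in> W" using * assms(2) rank_in unfolding name_def by auto
  then show ?thesis using elts_in unfolding ord_le_def elem_iff by auto
qed

section \<open>Names for sets of ground model elements\<close>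

text \<open>A fixed point \<open>E\<close> of \<open>forcing_step\<close> consists of codes of triples \<open>(\<sigma>, x, p)\<close> such that \<open>p\<close>
  forces the name \<open>\<sigma>\<close> to denote the ground model set \<open>x\<close>.  Working with \<open>x\<close> itself instead of its
  canonical name, and with any fixed point instead of one defined by recursion on names, keeps the
  construction of \<open>E\<close> inside a single application of Separation.\<close>

definition forcing_step :: "'v \<Rightarrow> 'v \<Rightarrow> 'v \<Rightarrow> 'v \<Rightarrow> bool" where
  "forcing_step E \<sigma> x p \<longleftrightarrow>
    (\<forall>\<pi>\<in>W. \<forall>s\<in>elts P. \<forall>r\<in>elts P. (\<pi>, s) \<in> rel_of \<sigma> \<and> le r p \<and> le r s \<longrightarrow>
      (\<exists>q\<in>elts P. le q r \<and> (\<exists>z\<in>elts x. pair \<pi> (pair z q) \<in> elts E))) \<and>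
    (\<forall>z\<in>elts x. \<forall>r\<in>elts P. le r p \<longrightarrow>
      (\<exists>q\<in>elts P. le q r \<and> (\<exists>\<pi>\<in>W. \<exists>s\<in>elts P. (\<pi>, s) \<in> rel_of \<sigma> \<and> le q s \<and>
        pair \<pi> (pair z q) \<in> elts E)))"

lemma forcing_step_mono: "elts E \<subseteq> elts E' \<Longrightarrow> forcing_step E \<sigma> x p \<Longrightarrow> forcing_step E' \<sigma> x p"
  unfolding forcing_step_def by (meson subsetD)

lemma forcing_step_open: "forcing_step E \<sigma> x p \<Longrightarrow> le q p \<Longrightarrow> forcing_step E \<sigma> x q"
  unfolding forcing_step_def using le_trans by meson

text \<open>\<open>E\<close> is the greatest fixed point, the union of all R with every triple
  justified by \<open>forcing_step R\<close>. Monotonicity makes \<open>E\<close> such an R;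
  adjoining a triple justified by \<open>E\<close> gives another one, so that triple was in
  \<open>E\<close> already.\<close>

lemma ex_forcing_relation:
  assumes t: "t \<in> W"
  obtains E where "E \<in> W" "\<And>\<sigma> x p. \<sigma> \<in> elts t \<Longrightarrow> x \<in> elts t \<Longrightarrow> p \<in> elts P \<Longrightarrow>
    pair \<sigma> (pair x p) \<in> elts E \<longleftrightarrow> forcing_step E \<sigma> x p"
proof -
  define B where "B = product t (product t P)"
  have B: "B \<in> W" unfolding B_def by (intro product_in t P_in)
  have B_iff: "pair \<sigma> (pair x p) \<in> elts B \<longleftrightarrow> \<sigma> \<in> elts t \<and> x \<in> elts t \<and> p \<in> elts P"
    if "\<sigma> \<in> W" "x \<in> W" "p \<in> W" for \<sigma> x p
    unfolding B_def using that t P_in by (simp add: pair_in_product pair_in product_in)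
  define good where "good R \<longleftrightarrow> (\<forall>\<sigma>\<in>elts t. \<forall>x\<in>elts t. \<forall>p\<in>elts P.
    pair \<sigma> (pair x p) \<in> elts R \<longrightarrow> forcing_step R \<sigma> x p)" for R
  have good_def2: "definable (\<lambda>e. good (e 0))"
    unfolding good_def forcing_step_def by (intro force_intros t)
  have "is_set {w \<in> elts B. \<exists>R\<in>W. elts R \<subseteq> elts B \<and> good R \<and> w \<in> elts R}"
    by (rule is_set_sep[OF B]) (intro force_intros B definable_unary[OF good_def2])
  then obtain E where E: "E \<in> W"
    "elts E = {w \<in> elts B. \<exists>R\<in>W. elts R \<subseteq> elts B \<and> good R \<and> w \<in> elts R}"
    unfolding is_set_def by auto
  have sub: "elts R \<subseteq> elts E" if "R \<in> W" "elts R \<subseteq> elts B" "good R" for R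
    unfolding E(2) using that by blast
  have good_E: "forcing_step E \<sigma> x p"
    if trip: "\<sigma> \<in> elts t" "x \<in> elts t" "p \<in> elts P" "pair \<sigma> (pair x p) \<in> elts E" for \<sigma> x p
  proof -
    obtain R where R: "R \<in> W" "elts R \<subseteq> elts B" "good R" "pair \<sigma> (pair x p) \<in> elts R"
      using trip(4) unfolding E(2) by blast
    then have "forcing_step R \<sigma> x p" using trip(1-3) unfolding good_def by blast
    then show ?thesis by (rule forcing_step_mono[OF sub[OF R(1-3)]])
  qed
  show thesis
  proof (rule that[OF E(1)])
    fix \<sigma> x p assume trip: "\<sigma> \<in> elts t" "x \<in> elts t" "p \<in> elts P"
    note in_W = elts_in[OF t trip(1)] elts_in[OF t trip(2)] P_elt[OF trip(3)]
    show "pair \<sigma> (pair x p) \<in> elts E \<longleftrightarrow> forcing_step E \<sigma> x p"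
    proof
      assume step: "forcing_step E \<sigma> x p"
      have "is_set (insert (pair \<sigma> (pair x p)) (elts E))"
        by (intro is_set_insert pair_in in_W is_set_elts E)
      then obtain R where R: "R \<in> W" "elts R = insert (pair \<sigma> (pair x p)) (elts E)"
        unfolding is_set_def by auto
      have ER: "elts E \<subseteq> elts R" unfolding R(2) by auto
      have "good R"
        unfolding good_def
      proof (intro ballI impI)
        fix \<sigma>' x' p' assume trip': "\<sigma>' \<in> elts t" "x' \<in> elts t" "p' \<in> elts P"
          "pair \<sigma>' (pair x' p') \<in> elts R"
        have "forcing_step E \<sigma>' x' p'"
        proof (cases "pair \<sigma>' (pair x' p') \<in> elts E")
          case True
          then show ?thesis using good_E trip' by blast
        next
          case False
          then have "pair \<sigma>' (pair x' p') = pair \<sigma> (pair x p)" using trip'(4) unfolding R(2) by blast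
          then have "\<sigma>' = \<sigma> \<and> x' = x \<and> p' = p"
            using in_W elts_in[OF t trip'(1)] elts_in[OF t trip'(2)] P_elt[OF trip'(3)]
            by (simp add: pair_inject pair_in)
          then show ?thesis using step by simp
        qed
        then show "forcing_step R \<sigma>' x' p'" by (rule forcing_step_mono[OF ER])
      qed
      moreover have "elts R \<subseteq> elts B" using B_iff[OF in_W] trip unfolding R(2) E(2) by auto
      ultimately have "elts R \<subseteq> elts E" by (rule sub[OF R(1), rotated])
      then show "pair \<sigma> (pair x p) \<in> elts E" unfolding R(2) by blast
    qed (rule good_E[OF trip])
  qed
qed

text \<open>Induction on the name works for every fixed point: \<open>forcing_step\<close> refers
  only to names occurring in \<sigma> and to elements of x, whose truth is known, and transitivity
  of t keeps all of these inside t. Openness of \<open>forcing_step\<close> passes to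
  \<open>E\<close> through the fixed point equation.\<close>

lemma forcing_relation_truth:
  assumes t: "t \<in> W" "\<And>x. x \<in> elts t \<Longrightarrow> elts x \<subseteq> elts t" and E: "E \<in> W"
    and fixed: "\<And>\<sigma> x p. \<sigma> \<in> elts t \<Longrightarrow> x \<in> elts t \<Longrightarrow> p \<in> elts P \<Longrightarrow>
      pair \<sigma> (pair x p) \<in> elts E \<longleftrightarrow> forcing_step E \<sigma> x p"
  shows "name \<sigma> \<Longrightarrow> \<sigma> \<in> elts t \<Longrightarrow> x \<in> elts t \<Longrightarrow>
    val \<sigma> = x \<longleftrightarrow> (\<exists>p\<in>T. pair \<sigma> (pair x p) \<in> elts E)"
proof (induction \<sigma> arbitrary: x rule: name_induct)
  case (name \<sigma>)
  note \<sigma> = elts_in[OF t(1) name(3)] and x = elts_in[OF t(1) name(4)]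
  have zt: "z \<in> elts t" if "z \<in> elts x" for z using t(2)[OF name(4)] that by blast
  have zW: "z \<in> W" if "z \<in> elts x" for z using elts_in[OF x that] .
  have \<pi>t: "\<pi> \<in> elts t" if \<pi>: "(\<pi>, s) \<in> rel_of \<sigma>" for \<pi> s
  proof -
    obtain z a where "z \<in> elts \<sigma>" "a \<in> elts z" "\<pi> \<in> elts a"
      using \<pi> unfolding rel_of_def elem_iff is_pair_def by auto
    then show ?thesis using t(2) name(3) by blast
  qed
  have \<pi>s: "\<pi> \<in> W \<and> s \<in> elts P" if "(\<pi>, s) \<in> rel_of \<sigma>" for \<pi> s
    using name_elem[OF name(1) that] unfolding name_def by blast
  have IH: "val \<pi> = z \<longleftrightarrow> (\<exists>p\<in>T. pair \<pi> (pair z p) \<in> elts E)"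
    if "(\<pi>, s) \<in> rel_of \<sigma>" "z \<in> elts x" for \<pi> s z
    using name(2)[OF that(1) \<pi>t[OF that(1)] zt[OF that(2)]] .
  have mono: "pair \<pi> (pair z q) \<in> elts E"
    if "(\<pi>, s) \<in> rel_of \<sigma>" "z \<in> elts x" "pair \<pi> (pair z p) \<in> elts E" "p \<in> elts P"
      "le q p" "q \<in> elts P" for \<pi> s z p q
    using fixed[OF \<pi>t[OF that(1)] zt[OF that(2)]] that(3-6) forcing_step_open by blast
  show ?case
  proof
    assume "\<exists>p\<in>T. pair \<sigma> (pair x p) \<in> elts E"
    then obtain p where p: "p \<in> T" "pair \<sigma> (pair x p) \<in> elts E" by blast
    then have step: "forcing_step E \<sigma> x p" using fixed name T_subset by blast
    have "v \<in> elts x" if v: "v \<in> elts (val \<sigma>)" for v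
    proof -
      obtain \<pi> s where s: "s \<in> T" "(\<pi>, s) \<in> rel_of \<sigma>" "v = val \<pi>"
        using v unfolding elts_val[OF name(1)] by blast
      have \<pi>W: "\<pi> \<in> W" using \<pi>s[OF s(2)] by blast
      obtain r where r: "r \<in> T" "le r p" "le r s" using T_directed[OF p(1) s(1)] by blast
      have "\<exists>q\<in>T. \<exists>z\<in>elts x. pair \<pi> (pair z q) \<in> elts E"
      proof (rule generic_below[OF _ r(1)])
        show "definable (\<lambda>e. \<exists>z\<in>elts x. pair \<pi> (pair z (e 0)) \<in> elts E)"
          by (intro force_intros x \<pi>W E)
        show "\<exists>q\<in>elts P. le q r' \<and> (\<exists>z\<in>elts x. pair \<pi> (pair z q) \<in> elts E)"
          if "r' \<in> elts P" "le r' r" for r'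
          using step that \<pi>W \<pi>s[OF s(2)] s(2) le_trans[OF that(2)] r unfolding forcing_step_def by blast
      qed
      then obtain q z where "q \<in> T" "z \<in> elts x" "pair \<pi> (pair z q) \<in> elts E" by blast
      then show ?thesis using IH[OF s(2)] s(3) by blast
    qed
    moreover have "z \<in> elts (val \<sigma>)" if z: "z \<in> elts x" for z
    proof -
      have "\<exists>q\<in>T. \<exists>\<pi>\<in>W. \<exists>s\<in>elts P. (\<pi>, s) \<in> rel_of \<sigma> \<and> le q s \<and> pair \<pi> (pair z q) \<in> elts E"
      proof (rule generic_below[OF _ p(1)])
        show "definable (\<lambda>e. \<exists>\<pi>\<in>W. \<exists>s\<in>elts P. (\<pi>, s) \<in> rel_of \<sigma> \<and> le (e 0) s \<and>
          pair \<pi> (pair z (e 0)) \<in> elts E)"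
          by (intro force_intros \<sigma> zW[OF z] E)
      qed (use step z in \<open>unfold forcing_step_def, blast\<close>)
      then obtain q \<pi> s where q: "q \<in> T" "s \<in> elts P" "(\<pi>, s) \<in> rel_of \<sigma>" "le q s"
        "pair \<pi> (pair z q) \<in> elts E" by blast
      then have "val \<pi> = z" using IH z by blast
      moreover have "s \<in> T" using T_upward q by blast
      ultimately show ?thesis unfolding elts_val[OF name(1)] using q(3) by blast
    qed
    ultimately have "elts (val \<sigma>) = elts x" by blast
    then show "val \<sigma> = x" by simp
  next
    assume val_x: "val \<sigma> = x"
    \<comment> \<open>Failure of \<open>forcing_step\<close> below a condition leaves a witness:
      \<open>N1\<close> gives a name put into \<sigma> that no extension makes equal to an element
      of x, \<open>N2\<close> an element of x that no extension puts into the value of \<sigma>. For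
      a member of \<open>T\<close> either contradicts \<open>val \<sigma> = x\<close> by the
      induction hypothesis.\<close>
    define N1 where "N1 p \<longleftrightarrow> (\<exists>\<pi>\<in>W. \<exists>s\<in>elts P. (\<pi>, s) \<in> rel_of \<sigma> \<and> le p s \<and>
      (\<forall>q\<in>elts P. le q p \<longrightarrow> (\<forall>z\<in>elts x. pair \<pi> (pair z q) \<notin> elts E)))" for p
    define N2 where "N2 p \<longleftrightarrow> (\<exists>z\<in>elts x. \<forall>q\<in>elts P. le q p \<longrightarrow>
      (\<forall>\<pi>\<in>W. \<forall>s\<in>elts P. (\<pi>, s) \<in> rel_of \<sigma> \<and> le q s \<longrightarrow> pair \<pi> (pair z q) \<notin> elts E))" for p
    obtain p0 where p0: "p0 \<in> T" using T_nonempty by blast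
    have "\<exists>p\<in>T. pair \<sigma> (pair x p) \<in> elts E \<or> N1 p \<or> N2 p"
    proof (rule generic_below[OF _ p0])
      show "definable (\<lambda>e. pair \<sigma> (pair x (e 0)) \<in> elts E \<or> N1 (e 0) \<or> N2 (e 0))"
        unfolding N1_def N2_def by (intro force_intros \<sigma> x E)
      fix p assume p: "p \<in> elts P"
      show "\<exists>r\<in>elts P. le r p \<and> (pair \<sigma> (pair x r) \<in> elts E \<or> N1 r \<or> N2 r)"
      proof (cases "forcing_step E \<sigma> x p")
        case True
        then show ?thesis using fixed[OF name(3,4) p] p le_refl by blast
      next
        case False
        then show ?thesis unfolding forcing_step_def N1_def N2_def using p by blast
      qed
    qed
    then obtain p where p: "p \<in> T" "pair \<sigma> (pair x p) \<in> elts E \<or> N1 p \<or> N2 p" by blast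
    have "\<not> N1 p"
    proof
      assume "N1 p"
      then obtain \<pi> s where s: "(\<pi>, s) \<in> rel_of \<sigma>" "s \<in> elts P" "le p s"
        "\<forall>q\<in>elts P. le q p \<longrightarrow> (\<forall>z\<in>elts x. pair \<pi> (pair z q) \<notin> elts E)"
        unfolding N1_def by blast
      have "s \<in> T" using T_upward p(1) s by blast
      then have z: "val \<pi> \<in> elts x" using s(1) val_x elts_val[OF name(1)] by blast
      obtain p' where p': "p' \<in> T" "pair \<pi> (pair (val \<pi>) p') \<in> elts E" using IH[OF s(1) z] by blast
      obtain q where q: "q \<in> T" "le q p" "le q p'" using T_directed[OF p(1) p'(1)] by blast
      have "pair \<pi> (pair (val \<pi>) q) \<in> elts E"
        by (rule mono[OF s(1) z p'(2) T_subset[OF p'(1)] q(3) T_subset[OF q(1)]])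
      then show False using s(4) T_subset[OF q(1)] q(2) z by blast
    qed
    moreover have "\<not> N2 p"
    proof
      assume "N2 p"
      then obtain z where z: "z \<in> elts x" "\<forall>q\<in>elts P. le q p \<longrightarrow>
        (\<forall>\<pi>\<in>W. \<forall>s\<in>elts P. (\<pi>, s) \<in> rel_of \<sigma> \<and> le q s \<longrightarrow> pair \<pi> (pair z q) \<notin> elts E)"
        unfolding N2_def by blast
      have "z \<in> elts (val \<sigma>)" using z(1) val_x by simp
      then obtain \<pi> s where s: "s \<in> T" "(\<pi>, s) \<in> rel_of \<sigma>" "z = val \<pi>"
        unfolding elts_val[OF name(1)] by blast
      obtain p' where p': "p' \<in> T" "pair \<pi> (pair z p') \<in> elts E" using IH[OF s(2) z(1)] s(3) by blast
      obtain r where r: "r \<in> T" "le r p" "le r p'" using T_directed[OF p(1) p'(1)] by blast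
      obtain q where q: "q \<in> T" "le q r" "le q s" using T_directed[OF r(1) s(1)] by blast
      have "pair \<pi> (pair z q) \<in> elts E"
        by (rule mono[OF s(2) z(1) p'(2) T_subset[OF p'(1)] le_trans[OF q(2) r(3)] T_subset[OF q(1)]])
      then show False
        using z(2) T_subset[OF q(1)] le_trans[OF q(2) r(2)] \<pi>s[OF s(2)] s(2) q(3) by blast
    qed
    ultimately show "\<exists>p\<in>T. pair \<sigma> (pair x p) \<in> elts E" using p by blast
  qed
qed

text \<open>The converse of \<open>ex_realization\<close>. The code contains (p, x) when p extends a
  condition attached in the name \<tau> of y to some \<sigma> and forces \<sigma> to denote x; the
  truth of this relation on a gives the two inclusions.\<close>

lemma ex_code:
  assumes y: "y \<in> WT" and a: "a \<in> W" and ya: "elts y \<subseteq> elts a"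
  obtains U where "U \<in> W" "realization U = elts y"
    "\<And>p x. (p, x) \<in> rel_of U \<Longrightarrow> p \<in> elts P \<and> x \<in> elts a"
proof -
  obtain \<tau> where \<tau>: "name \<tau>" "y = val \<tau>" using y WT_iff by blast
  have \<tau>W: "\<tau> \<in> W" using \<tau>(1) unfolding name_def by blast
  \<comment> \<open>The closure of the pair is one transitive set containing both \<tau> and a,
    hence all names occurring in \<tau> and all elements of a.\<close>
  obtain t where t: "t \<in> W" "is_closure (pair \<tau> a) t" using ex_closure[OF pair_in[OF \<tau>W a]] by blast
  have t_t: "elts x \<subseteq> elts t" if "x \<in> elts t" for x using t(2) that unfolding is_closure_def by blast
  obtain b where "b \<in> elts (pair \<tau> a)" "elts b = {\<tau>, a}"
    using is_pair_pair[OF \<tau>W a] unfolding is_pair_def by auto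
  then have "\<tau> \<in> elts t" "a \<in> elts t" using t(2) unfolding is_closure_def by blast+
  have at: "x \<in> elts t" if "x \<in> elts a" for x using t_t[OF \<open>a \<in> elts t\<close>] that by blast
  have \<sigma>t: "\<sigma> \<in> elts t" if \<sigma>: "(\<sigma>, s) \<in> rel_of \<tau>" for \<sigma> s
  proof -
    obtain z a where "z \<in> elts \<tau>" "a \<in> elts z" "\<sigma> \<in> elts a"
      using \<sigma> unfolding rel_of_def elem_iff is_pair_def by auto
    then show ?thesis using t_t \<open>\<tau> \<in> elts t\<close> by blast
  qed
  obtain E where E: "E \<in> W" "\<And>\<sigma> x p. \<sigma> \<in> elts t \<Longrightarrow> x \<in> elts t \<Longrightarrow> p \<in> elts P \<Longrightarrow>
    pair \<sigma> (pair x p) \<in> elts E \<longleftrightarrow> forcing_step E \<sigma> x p"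
    using ex_forcing_relation[OF t(1)] by blast
  have truth: "val \<sigma> = x \<longleftrightarrow> (\<exists>p\<in>T. pair \<sigma> (pair x p) \<in> elts E)"
    if "(\<sigma>, s) \<in> rel_of \<tau>" "x \<in> elts a" for \<sigma> s x
    by (rule forcing_relation_truth[OF t(1) t_t E name_elem(1)[OF \<tau>(1) that(1)] \<sigma>t[OF that(1)] at[OF that(2)]])
  have "is_set {w \<in> elts (product P a). \<exists>p\<in>elts P. \<exists>x\<in>elts a. w = pair p x \<and>
    (\<exists>\<sigma>\<in>W. \<exists>s\<in>elts P. (\<sigma>, s) \<in> rel_of \<tau> \<and> le p s \<and> pair \<sigma> (pair x p) \<in> elts E)}"
    by (rule is_set_sep[OF product_in[OF P_in a]]) (intro force_intros a \<tau>W E)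
  then obtain U where U: "U \<in> W" "elts U = {w \<in> elts (product P a). \<exists>p\<in>elts P. \<exists>x\<in>elts a. w = pair p x \<and>
    (\<exists>\<sigma>\<in>W. \<exists>s\<in>elts P. (\<sigma>, s) \<in> rel_of \<tau> \<and> le p s \<and> pair \<sigma> (pair x p) \<in> elts E)}"
    unfolding is_set_def by auto
  have U_iff: "(p, x) \<in> rel_of U \<longleftrightarrow> p \<in> elts P \<and> x \<in> elts a \<and>
    (\<exists>\<sigma>\<in>W. \<exists>s\<in>elts P. (\<sigma>, s) \<in> rel_of \<tau> \<and> le p s \<and> pair \<sigma> (pair x p) \<in> elts E)" (is "?L \<longleftrightarrow> ?R") for p x
  proof
    assume L: ?L
    then have W: "p \<in> W" "x \<in> W" using rel_of_in[OF U(1)] by auto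
    then obtain p' x' where *: "p' \<in> elts P" "x' \<in> elts a" "pair p x = pair p' x'"
      "\<exists>\<sigma>\<in>W. \<exists>s\<in>elts P. (\<sigma>, s) \<in> rel_of \<tau> \<and> le p' s \<and> pair \<sigma> (pair x' p') \<in> elts E"
      using L unfolding rel_of_iff[OF W] U(2) mem_Collect_eq by metis
    then have "p' = p" "x' = x" using pair_inject W P_elt elts_in[OF a] by metis+
    then show ?R using * by simp
  next
    assume R: ?R
    then have W: "p \<in> W" "x \<in> W" using P_elt elts_in[OF a] by auto
    show ?L unfolding rel_of_iff[OF W] U(2) using R pair_in_product[OF P_in a W] by blast
  qed
  show thesis
  proof (rule that[OF U(1)])
    show "realization U = elts y"
    proof (intro set_eqI iffI)
      fix x assume "x \<in> realization U"
      then obtain p where p: "p \<in> T" "(p, x) \<in> rel_of U" unfolding realization_def by blast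
      then obtain \<sigma> s where s: "s \<in> elts P" "(\<sigma>, s) \<in> rel_of \<tau>" "le p s" "pair \<sigma> (pair x p) \<in> elts E"
        "x \<in> elts a" unfolding U_iff by blast
      have "val \<sigma> = x" using truth[OF s(2,5)] p(1) s(4) by blast
      moreover have "s \<in> T" using T_upward p(1) s by blast
      ultimately show "x \<in> elts y" unfolding \<tau>(2) elts_val[OF \<tau>(1)] using s(2) by blast
    next
      fix x assume x: "x \<in> elts y"
      then have xa: "x \<in> elts a" using ya by blast
      obtain \<sigma> s where s: "s \<in> T" "(\<sigma>, s) \<in> rel_of \<tau>" "x = val \<sigma>"
        using x unfolding \<tau>(2) elts_val[OF \<tau>(1)] by blast
      then obtain p where p: "p \<in> T" "pair \<sigma> (pair x p) \<in> elts E" using truth[OF s(2) xa] by blast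
      obtain q where q: "q \<in> T" "le q p" "le q s" using T_directed[OF p(1) s(1)] by blast
      have "pair \<sigma> (pair x q) \<in> elts E"
        using E(2)[OF \<sigma>t[OF s(2)] at[OF xa]] p q T_subset forcing_step_open by blast
      moreover have "\<sigma> \<in> W" using name_elem[OF \<tau>(1) s(2)] unfolding name_def by blast
      ultimately have "(q, x) \<in> rel_of U" unfolding U_iff using T_subset q s xa by blast
      then show "x \<in> realization U" unfolding realization_def using q(1) by blast
    qed
  qed (simp add: U_iff)
qed

text \<open>The forcing relation for membership in the realization of \<open>U\<close>: the
  conditions lying below one attached to \<alpha> are dense below p. Together with
  \<open>forces_out\<close>, which forbids such conditions, it replaces a forcing relation for
  general formulas.\<close>

definition forces_in :: "'v \<Rightarrow> 'v \<Rightarrow> 'v \<Rightarrow> bool" where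
  "forces_in U p \<alpha> \<longleftrightarrow> (\<forall>q\<in>elts P. le q p \<longrightarrow>
    (\<exists>r\<in>elts P. le r q \<and> (\<exists>u\<in>elts P. le r u \<and> (u, \<alpha>) \<in> rel_of U)))"

definition forces_out :: "'v \<Rightarrow> 'v \<Rightarrow> 'v \<Rightarrow> bool" where
  "forces_out U p \<alpha> \<longleftrightarrow> (\<forall>q\<in>elts P. le q p \<longrightarrow>
    \<not> (\<exists>u\<in>elts P. le q u \<and> (u, \<alpha>) \<in> rel_of U))"

text \<open>Disagreement is symmetric and does not mention X, so it is definable in
  \<open>W\<close>. Once one of the two conditions is known to lie in \<open>T\<close>, the other
  one is wrong.\<close>

definition differ :: "'v \<Rightarrow> 'v \<Rightarrow> 'v \<Rightarrow> 'v \<Rightarrow> bool" where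
  "differ U p q \<alpha> \<longleftrightarrow> forces_in U p \<alpha> \<and> forces_out U q \<alpha> \<or> forces_out U p \<alpha> \<and> forces_in U q \<alpha>"

section \<open>Fresh sets\<close>

abbreviation compat :: "'v \<Rightarrow> 'v \<Rightarrow> bool" where
  "compat \<equiv> compatible P leq"

lemma compat_sym: "compat p q \<Longrightarrow> compat q p"
  unfolding compatible_def by blast

lemma compat_T: "p \<in> T \<Longrightarrow> q \<in> T \<Longrightarrow> compat p q"
  unfolding compatible_def using T_directed T_subset by blast

section \<open>Deciding membership in a coded set\<close>

lemma forces_in_open: "forces_in U p \<alpha> \<Longrightarrow> le q p \<Longrightarrow> forces_in U q \<alpha>"
  unfolding forces_in_def using le_trans by blast

lemma forces_out_open: "forces_out U p \<alpha> \<Longrightarrow> le q p \<Longrightarrow> forces_out U q \<alpha>"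
  unfolding forces_out_def using le_trans by blast

lemma not_forces_in_out: "p \<in> elts P \<Longrightarrow> forces_in U p \<alpha> \<Longrightarrow> \<not> forces_out U p \<alpha>"
  unfolding forces_in_def forces_out_def using le_refl by blast

lemma forces_in_if: "\<not> (\<exists>r\<in>elts P. le r p \<and> forces_out U r \<alpha>) \<Longrightarrow> forces_in U p \<alpha>"
  unfolding forces_in_def forces_out_def by blast

lemma forces_in_code: "u \<in> elts P \<Longrightarrow> le q u \<Longrightarrow> (u, \<alpha>) \<in> rel_of U \<Longrightarrow> forces_in U q \<alpha>"
  unfolding forces_in_def using le_refl le_trans by blast

lemma forces_out_if: "\<not> (\<exists>r\<in>elts P. le r p \<and> forces_in U r \<alpha>) \<Longrightarrow> forces_out U p \<alpha>"
  unfolding forces_out_def using forces_in_code by blast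

lemma realization_forces_in:
  assumes "U \<in> W" "\<And>p x. (p, x) \<in> rel_of U \<Longrightarrow> p \<in> elts P"
  shows "\<alpha> \<in> realization U \<longleftrightarrow> (\<exists>p\<in>T. forces_in U p \<alpha>)"
proof
  assume "\<alpha> \<in> realization U"
  then obtain p where "p \<in> T" "(p, \<alpha>) \<in> rel_of U" unfolding realization_def by blast
  then show "\<exists>p\<in>T. forces_in U p \<alpha>" using forces_in_code T_subset le_refl by blast
next
  assume "\<exists>p\<in>T. forces_in U p \<alpha>"
  then obtain p where p: "p \<in> T" "forces_in U p \<alpha>" by blast
  obtain u where "(u, \<alpha>) \<in> rel_of U"
    using p T_subset le_refl unfolding forces_in_def by blast
  then have \<alpha>: "\<alpha> \<in> W" using rel_of_in assms(1) by blast
  have "\<exists>q\<in>T. \<exists>u\<in>elts P. le q u \<and> (u, \<alpha>) \<in> rel_of U"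
  proof (rule generic_below[OF _ p(1)])
    show "definable (\<lambda>e. \<exists>u\<in>elts P. le (e 0) u \<and> (u, \<alpha>) \<in> rel_of U)"
      by (intro force_intros \<alpha> assms)
  qed (use p(2) in \<open>unfold forces_in_def, blast\<close>)
  then show "\<alpha> \<in> realization U" unfolding realization_def using T_upward by blast
qed

lemma realization_forces_out:
  assumes "p \<in> T" "forces_out U p \<alpha>" "\<And>p x. (p, x) \<in> rel_of U \<Longrightarrow> p \<in> elts P"
  shows "\<alpha> \<notin> realization U"
proof
  assume "\<alpha> \<in> realization U"
  then obtain u where u: "u \<in> T" "(u, \<alpha>) \<in> rel_of U" unfolding realization_def by blast
  obtain q where "q \<in> T" "le q p" "le q u" using T_directed assms(1) u(1) by blast
  then show False using assms(2) u T_subset unfolding forces_out_def by blast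
qed

lemma no_fresh:
  assumes \<mu>: "\<mu> \<in> WT" "is_ordinal \<mu>"
    and X: "X \<in> WT" "X \<notin> W" "elts X \<subseteq> elts \<mu>"
    and initial: "\<And>\<xi>. \<xi> \<in> elts \<mu> \<Longrightarrow> \<exists>y\<in>W. elts y = elts X \<inter> elts \<xi>"
    and cof: "has_cofinality WT \<mu> \<theta>" and cc: "chain_condition WT P leq \<theta>"
  shows False
proof -
  have \<mu>W: "\<mu> \<in> W" by (rule ordinal_in_ground[OF \<mu>])
  obtain U where U: "U \<in> W" "realization U = elts X"
    and U_rel: "\<And>p x. (p, x) \<in> rel_of U \<Longrightarrow> p \<in> elts P \<and> x \<in> elts \<mu>"
    using ex_code[OF X(1) \<mu>W X(3)] by blast
  have U_P: "\<And>p x. (p, x) \<in> rel_of U \<Longrightarrow> p \<in> elts P" using U_rel by blast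
  have X_iff: "\<alpha> \<in> elts X \<longleftrightarrow> (\<exists>p\<in>T. forces_in U p \<alpha>)" for \<alpha>
    using realization_forces_in[OF U(1) U_P] U(2) by simp
  have not_X: "\<alpha> \<notin> elts X" if "p \<in> T" "forces_out U p \<alpha>" for p \<alpha>
    using realization_forces_out[OF that U_P] U(2) by simp

  have decide: "\<exists>p\<in>T. \<forall>\<alpha>\<in>elts \<xi>. (\<alpha> \<in> elts X \<longrightarrow> forces_in U p \<alpha>) \<and> (\<alpha> \<notin> elts X \<longrightarrow> forces_out U p \<alpha>)"
    if \<xi>: "\<xi> \<in> elts \<mu>" for \<xi>
  proof -
    obtain y where y: "y \<in> W" "elts y = elts X \<inter> elts \<xi>" using initial[OF \<xi>] by blast
    \<comment> \<open>\<open>good\<close> and \<open>bad\<close> compare the decisions of p with y,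
      which is in \<open>W\<close>, instead of X. A condition without bad extensions is good, and no
      member of \<open>T\<close> is bad because y agrees with X below \<xi>.\<close>
    define good where "good p \<longleftrightarrow> (\<forall>\<alpha>\<in>elts \<xi>. (\<alpha> \<in> elts y \<longrightarrow> forces_in U p \<alpha>) \<and> (\<alpha> \<notin> elts y \<longrightarrow> forces_out U p \<alpha>))" for p
    define bad where "bad p \<longleftrightarrow> (\<exists>\<alpha>\<in>elts \<xi>. \<alpha> \<in> elts y \<and> forces_out U p \<alpha> \<or> \<alpha> \<notin> elts y \<and> forces_in U p \<alpha>)" for p
    obtain p0 where p0: "p0 \<in> T" using T_nonempty by blast
    have "\<exists>p\<in>T. good p \<or> bad p"
    proof (rule generic_below[OF _ p0])
      show "definable (\<lambda>e. good (e 0) \<or> bad (e 0))"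
        unfolding good_def bad_def forces_in_def forces_out_def
        by (intro force_intros y U elts_in[OF \<mu>W \<xi>])
      fix p assume p: "p \<in> elts P"
      show "\<exists>r\<in>elts P. le r p \<and> (good r \<or> bad r)"
      proof (cases "\<exists>r\<in>elts P. le r p \<and> bad r")
        case False
        have "good p"
          unfolding good_def
        proof (intro ballI conjI impI)
          fix \<alpha> assume \<alpha>: "\<alpha> \<in> elts \<xi>"
          show "forces_in U p \<alpha>" if "\<alpha> \<in> elts y"
            by (rule forces_in_if) (use False that \<alpha> in \<open>unfold bad_def, blast\<close>)
          show "forces_out U p \<alpha>" if "\<alpha> \<notin> elts y"
            by (rule forces_out_if) (use False that \<alpha> in \<open>unfold bad_def, blast\<close>)
        qed
        then show ?thesis using p le_refl by blast
      qed blast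
    qed
    then obtain p where p: "p \<in> T" "good p \<or> bad p" by blast
    moreover have "\<not> bad p"
      unfolding bad_def using X_iff not_X p(1) y(2) by blast
    ultimately have "good p" by blast
    then show ?thesis unfolding good_def using p(1) y(2) by blast
  qed

  \<comment> \<open>Otherwise no extension of p disagrees with a member of \<open>T\<close>. Then p
    forces in every element of X, so X is the set of \<alpha> in \<mu> forced in by p, which lies in
    \<open>W\<close> by Separation.\<close>
  have differs: "\<exists>r\<in>elts P. le r p \<and> (\<exists>p'\<in>T. \<exists>\<alpha>\<in>elts \<mu>. differ U p' r \<alpha>)" if p: "p \<in> T" for p
  proof (rule ccontr)
    assume *: "\<not> ?thesis"
    have "\<alpha> \<in> elts X \<longleftrightarrow> forces_in U p \<alpha>" if \<alpha>: "\<alpha> \<in> elts \<mu>" for \<alpha>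
    proof
      assume "\<alpha> \<in> elts X"
      then obtain p' where "p' \<in> T" "forces_in U p' \<alpha>" using X_iff by blast
      then have "\<not> (\<exists>r\<in>elts P. le r p \<and> forces_out U r \<alpha>)"
        using * \<alpha> unfolding differ_def by blast
      then show "forces_in U p \<alpha>" by (rule forces_in_if)
    qed (use p X_iff in blast)
    then have "elts X = {\<alpha> \<in> elts \<mu>. forces_in U p \<alpha>}" using X(3) by blast
    moreover have "is_set {\<alpha> \<in> elts \<mu>. forces_in U p \<alpha>}"
      by (rule is_set_sep[OF \<mu>W], unfold forces_in_def) (intro force_intros U P_elt[OF T_subset[OF p]])
    ultimately have "X \<in> W" unfolding is_set_def by (metis elts_inject)
    then show False using X(2) by contradiction
  qed

  define S where "S = {w \<in> elts (product P (product P \<mu>)).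
    \<exists>p\<in>elts P. \<exists>q\<in>elts P. \<exists>\<alpha>\<in>elts \<mu>. w = pair p (pair q \<alpha>) \<and> differ U p q \<alpha>}"
  have "is_set S"
    unfolding S_def
    by (rule is_set_sep[OF product_in[OF P_in product_in[OF P_in \<mu>W]]],
        unfold differ_def forces_in_def forces_out_def) (intro force_intros \<mu>W U)
  then obtain s where s: "s \<in> W" "elts s = S" unfolding is_set_def by auto
  have \<mu>E: "\<alpha> \<in> W" if "\<alpha> \<in> elts \<mu>" for \<alpha> by (rule elts_in[OF \<mu>W that])
  have pair3: "p = p' \<and> q = q' \<and> \<alpha> = \<alpha>'"
    if "pair p (pair q \<alpha>) = pair p' (pair q' \<alpha>')" "p \<in> W" "q \<in> W" "\<alpha> \<in> W" "p' \<in> W" "q' \<in> W" "\<alpha>' \<in> W"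
    for p q \<alpha> p' q' \<alpha>'
    using that by (simp add: pair_inject pair_in)
  have S_iff: "pair p (pair q \<alpha>) \<in> S \<longleftrightarrow> differ U p q \<alpha>"
    if "p \<in> elts P" "q \<in> elts P" "\<alpha> \<in> elts \<mu>" for p q \<alpha>
  proof -
    have W: "p \<in> W" "q \<in> W" "\<alpha> \<in> W" using that P_elt \<mu>E by auto
    have "pair p (pair q \<alpha>) \<in> elts (product P (product P \<mu>))"
      using that W P_in \<mu>W by (simp add: pair_in_product pair_in product_in)
    then show ?thesis
      unfolding S_def using that pair3[OF _ W P_elt P_elt \<mu>E] by blast
  qed
  \<comment> \<open>Two triples are related when they are not compatible in both outer conditions.
    Quantifying over all decompositions of w and w' avoids projection functions.\<close>
  define Q where "Q w w' \<longleftrightarrow> (\<forall>p\<in>elts P. \<forall>q\<in>elts P. \<forall>\<alpha>\<in>elts \<mu>. \<forall>p'\<in>elts P. \<forall>q'\<in>elts P. \<forall>\<alpha>'\<in>elts \<mu>.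
    w = pair p (pair q \<alpha>) \<and> w' = pair p' (pair q' \<alpha>') \<longrightarrow> \<not> (compat p p' \<and> compat q q'))" for w w'
  have Q_def2: "definable (\<lambda>e. Q (e 0) (e (Suc 0)))"
    unfolding Q_def compatible_def by (intro force_intros \<mu>W)
  have Q_sym: "Q w' w" if "Q w w'" for w w'
    using that compat_sym unfolding Q_def by meson
  obtain V where V: "V \<in> W" "elts V \<subseteq> S"
    and clique: "\<And>x y. x \<in> elts V \<Longrightarrow> y \<in> elts V \<Longrightarrow> x \<noteq> y \<Longrightarrow> Q x y"
    and maximal: "\<And>x. x \<in> S \<Longrightarrow> x \<in> elts V \<or> (\<exists>y\<in>elts V. \<not> Q x y)"
    using ex_maximal_clique[OF s(1) Q_def2 Q_sym] unfolding s(2) by metis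
  define M where "M p q \<alpha> \<longleftrightarrow> p \<in> elts P \<and> q \<in> elts P \<and> \<alpha> \<in> elts \<mu> \<and> pair p (pair q \<alpha>) \<in> elts V" for p q \<alpha>
  have M_differ: "differ U p q \<alpha>" if "M p q \<alpha>" for p q \<alpha>
    using that V(2) S_iff unfolding M_def by blast
  have M_unique: "q = q' \<and> \<alpha> = \<alpha>'"
    if M: "M p q \<alpha>" "M p' q' \<alpha>'" "compat p p'" "compat q q'" for p q \<alpha> p' q' \<alpha>'
  proof (cases "pair p (pair q \<alpha>) = pair p' (pair q' \<alpha>')")
    case True
    then show ?thesis using pair3[OF True] M(1,2) P_elt \<mu>E unfolding M_def by blast
  next
    case False
    then have "Q (pair p (pair q \<alpha>)) (pair p' (pair q' \<alpha>'))"
      using clique M(1,2) unfolding M_def by blast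
    then show ?thesis using M unfolding Q_def M_def by blast
  qed
  \<comment> \<open>\<open>F\<close> keeps the triples whose first coordinate is in
    \<open>T\<close>. Compatibility within \<open>T\<close> removes the first coordinate from
    \<open>M_unique\<close>, which makes the remaining conditions an antichain and \<open>F\<close>
    a function on it.\<close>
  define F where "F q \<alpha> \<longleftrightarrow> (\<exists>p\<in>T. M p q \<alpha>)" for q \<alpha>
  have F_in: "q \<in> elts P \<and> \<alpha> \<in> elts \<mu>" if "F q \<alpha>" for q \<alpha>
    using that unfolding F_def M_def by blast
  have F_unique: "q = q' \<and> \<alpha> = \<alpha>'" if "F q \<alpha>" "F q' \<alpha>'" "compat q q'" for q \<alpha> q' \<alpha>'
    using that M_unique compat_T unfolding F_def by blast
  have F_fun: "\<alpha> = \<alpha>'" if "F q \<alpha>" "F q \<alpha>'" for q \<alpha> \<alpha>'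
    using F_unique[OF that] F_in[OF that(1)] le_refl unfolding compatible_def by blast

  have "is_set {w \<in> elts (product P P). \<exists>p\<in>elts P. \<exists>q\<in>elts P. w = pair p q \<and>
      (\<exists>\<alpha>\<in>elts \<mu>. pair p (pair q \<alpha>) \<in> elts V)}"
    by (rule is_set_sep[OF product_in[OF P_in P_in]]) (intro force_intros \<mu>W V)
  then obtain UA where UA: "UA \<in> W" "elts UA = {w \<in> elts (product P P). \<exists>p\<in>elts P. \<exists>q\<in>elts P.
      w = pair p q \<and> (\<exists>\<alpha>\<in>elts \<mu>. pair p (pair q \<alpha>) \<in> elts V)}"
    unfolding is_set_def by auto
  have UA_iff: "(p, q) \<in> rel_of UA \<longleftrightarrow> (\<exists>\<alpha>. M p q \<alpha>)" (is "?L \<longleftrightarrow> ?R") for p q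
  proof
    assume L: ?L
    then have W: "p \<in> W" "q \<in> W" using rel_of_in[OF UA(1)] by auto
    obtain p' q' \<alpha> where "p' \<in> elts P" "q' \<in> elts P" "pair p q = pair p' q'" "\<alpha> \<in> elts \<mu>"
      "pair p' (pair q' \<alpha>) \<in> elts V"
      using L unfolding rel_of_iff[OF W] UA(2) mem_Collect_eq by metis
    moreover from this have "p' = p" "q' = q" using pair_inject W P_elt by metis+
    ultimately show ?R unfolding M_def by blast
  next
    assume R: ?R
    then have W: "p \<in> W" "q \<in> W" using P_elt unfolding M_def by auto
    show ?L unfolding rel_of_iff[OF W] UA(2) using R pair_in_product[OF P_in P_in W]
      unfolding M_def by blast
  qed
  obtain A where A: "A \<in> WT" "elts A = realization UA" using ex_realization[OF UA(1)] by blast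
  have A_iff: "q \<in> elts A \<longleftrightarrow> (\<exists>\<alpha>. F q \<alpha>)" for q
    unfolding A(2) realization_def UA_iff F_def by blast
  have "antichain P leq A"
    unfolding antichain_def using A_iff F_in F_unique by blast
  then have "size_less WT A \<theta>" using cc A(1) unfolding chain_condition_def by blast
  then obtain \<kappa> h hg where \<kappa>: "is_cardinal WT \<kappa>" "\<kappa> \<in> elts \<theta>"
    and h: "h \<in> WT" "is_graph h A hg" "bij_betw hg (elts A) (elts \<kappa>)"
    unfolding size_less_def equinumerous_def elem_iff by blast
  \<comment> \<open>Ordinals of the extension lie in \<open>W\<close>, so
    \<open>product P \<kappa>\<close> is in \<open>W\<close> and the enumeration \<open>h\<close>, a
    subset of it, has a code there.\<close>
  have \<kappa>W: "\<kappa> \<in> W" using \<kappa>(1) ordinal_in_ground unfolding is_cardinal_def by blast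
  have A_W: "q \<in> W" if "q \<in> elts A" for q using that A_iff F_in P_elt by blast
  have hg: "hg q \<in> elts \<kappa>" "hg q \<in> W" if "q \<in> elts A" for q
    using h(3) that elts_in[OF \<kappa>W] unfolding bij_betw_def by blast+
  have h_iff: "z \<in> elts h \<longleftrightarrow> (\<exists>q\<in>elts A. z = pair q (hg q))" for z
    using h(2) is_pair_iff[OF A_W hg(2)] unfolding is_graph_def elem_iff by blast
  have "elts h \<subseteq> elts (product P \<kappa>)"
  proof
    fix z assume "z \<in> elts h"
    then obtain q where q: "q \<in> elts A" "z = pair q (hg q)" unfolding h_iff by blast
    moreover have "q \<in> elts P" using q(1) A_iff F_in by blast
    ultimately show "z \<in> elts (product P \<kappa>)"
      using pair_in_product[OF P_in \<kappa>W A_W hg(2)] hg(1) by simp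
  qed
  then obtain H where H: "H \<in> W" "realization H = elts h"
    and H_rel: "\<And>p x. (p, x) \<in> rel_of H \<Longrightarrow> p \<in> elts P \<and> x \<in> elts (product P \<kappa>)"
    using ex_code[OF h(1) product_in[OF P_in \<kappa>W]] by blast

  \<comment> \<open>A code for the map from the index of q to its \<alpha>: p lies below p1, which
    puts (q, \<alpha>) into \<open>F\<close>, and below p2, which puts (q, i) into \<open>h\<close>.
    As \<open>T\<close> is upward closed and directed, such a p exists in \<open>T\<close> exactly
    when both memberships hold.\<close>
  define \<Phi> where "\<Phi> p i \<alpha> \<longleftrightarrow> (\<exists>q\<in>elts P. \<exists>p1\<in>elts P. \<exists>p2\<in>elts P. le p p1 \<and> le p p2 \<and>
    pair p1 (pair q \<alpha>) \<in> elts V \<and> (p2, pair q i) \<in> rel_of H)" for p i \<alpha>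
  have "is_set {w \<in> elts (product P (product \<kappa> \<mu>)). \<exists>p\<in>elts P. \<exists>i\<in>elts \<kappa>. \<exists>\<alpha>\<in>elts \<mu>.
      w = pair p (pair i \<alpha>) \<and> \<Phi> p i \<alpha>}"
    by (rule is_set_sep[OF product_in[OF P_in product_in[OF \<kappa>W \<mu>W]]], unfold \<Phi>_def)
      (intro force_intros \<mu>W V \<kappa>W H)
  then obtain G where G: "G \<in> W" "elts G = {w \<in> elts (product P (product \<kappa> \<mu>)).
      \<exists>p\<in>elts P. \<exists>i\<in>elts \<kappa>. \<exists>\<alpha>\<in>elts \<mu>. w = pair p (pair i \<alpha>) \<and> \<Phi> p i \<alpha>}"
    unfolding is_set_def by auto
  obtain g where g: "g \<in> WT" "elts g = realization G" using ex_realization[OF G(1)] by blast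
  have G_iff: "(p, w) \<in> rel_of G \<longleftrightarrow>
    p \<in> elts P \<and> (\<exists>i\<in>elts \<kappa>. \<exists>\<alpha>\<in>elts \<mu>. w = pair i \<alpha> \<and> \<Phi> p i \<alpha>)" (is "?L \<longleftrightarrow> ?R") for p w
  proof
    assume L: ?L
    then have W: "p \<in> W" "w \<in> W" using rel_of_in[OF G(1)] by auto
    obtain p' i \<alpha> where *: "p' \<in> elts P" "i \<in> elts \<kappa>" "\<alpha> \<in> elts \<mu>" "pair p w = pair p' (pair i \<alpha>)"
      "\<Phi> p' i \<alpha>"
      using L unfolding rel_of_iff[OF W] G(2) mem_Collect_eq by metis
    have "p = p' \<and> w = pair i \<alpha>"
      using pair_inject[OF W P_elt[OF *(1)] pair_in[OF elts_in[OF \<kappa>W *(2)] \<mu>E[OF *(3)]]] *(4) by blast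
    then show ?R using * by blast
  next
    assume R: ?R
    then obtain i \<alpha> where *: "p \<in> elts P" "i \<in> elts \<kappa>" "\<alpha> \<in> elts \<mu>" "w = pair i \<alpha>" "\<Phi> p i \<alpha>" by blast
    have W: "p \<in> W" "i \<in> W" "\<alpha> \<in> W" "w \<in> W" using * P_elt elts_in[OF \<kappa>W] \<mu>E pair_in by auto
    have "pair p w \<in> elts (product P (product \<kappa> \<mu>))"
      using * W P_in \<kappa>W \<mu>W by (simp add: pair_in_product pair_in product_in)
    then show ?L unfolding rel_of_iff[OF W(1,4)] G(2) using * by blast
  qed
  have g_iff: "z \<in> elts g \<longleftrightarrow> (\<exists>q\<in>elts A. \<exists>\<alpha>. F q \<alpha> \<and> z = pair (hg q) \<alpha>)" for z
  proof
    assume "z \<in> elts g"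
    then obtain p i \<alpha> where p: "p \<in> T" "i \<in> elts \<kappa>" "\<alpha> \<in> elts \<mu>" "z = pair i \<alpha>" "\<Phi> p i \<alpha>"
      unfolding g(2) realization_def G_iff by blast
    then obtain q p1 p2 where q: "q \<in> elts P" "p1 \<in> elts P" "p2 \<in> elts P" "le p p1" "le p p2"
      "pair p1 (pair q \<alpha>) \<in> elts V" "(p2, pair q i) \<in> rel_of H" unfolding \<Phi>_def by blast
    have "p1 \<in> T" "p2 \<in> T" using T_upward[OF p(1)] q by blast+
    then have "F q \<alpha>" unfolding F_def M_def using q p(3) by blast
    moreover have "pair q i \<in> elts h" unfolding H(2)[symmetric] realization_def using \<open>p2 \<in> T\<close> q(7) by blast
    then obtain q' where "q' \<in> elts A" "pair q i = pair q' (hg q')" using h_iff by blast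
    moreover from this have "q = q'" "i = hg q'"
      using pair_inject P_elt[OF q(1)] elts_in[OF \<kappa>W p(2)] A_W hg(2) by metis+
    ultimately show "\<exists>q\<in>elts A. \<exists>\<alpha>. F q \<alpha> \<and> z = pair (hg q) \<alpha>" using p(4) by blast
  next
    assume "\<exists>q\<in>elts A. \<exists>\<alpha>. F q \<alpha> \<and> z = pair (hg q) \<alpha>"
    then obtain q \<alpha> where q: "q \<in> elts A" "F q \<alpha>" "z = pair (hg q) \<alpha>" by blast
    then obtain p1 where p1: "p1 \<in> T" "M p1 q \<alpha>" unfolding F_def by blast
    have "pair q (hg q) \<in> realization H" unfolding H(2) using h_iff q(1) by blast
    then obtain p2 where p2: "p2 \<in> T" "(p2, pair q (hg q)) \<in> rel_of H" unfolding realization_def by blast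
    obtain p where p: "p \<in> T" "le p p1" "le p p2" using T_directed[OF p1(1) p2(1)] by blast
    have "\<Phi> p (hg q) \<alpha>" unfolding \<Phi>_def using p p1 p2 T_subset unfolding M_def by blast
    then have "(p, z) \<in> rel_of G" unfolding G_iff using q hg(1) F_in T_subset[OF p(1)] by blast
    then show "z \<in> elts g" unfolding g(2) realization_def using p(1) by blast
  qed
  define gg where "gg i = (THE \<alpha>. F (inv_into (elts A) hg i) \<alpha>)" for i
  have gg: "gg (hg q) = \<alpha>" if "F q \<alpha>" for q \<alpha>
  proof -
    have "inv_into (elts A) hg (hg q) = q"
      using h(3) that A_iff unfolding bij_betw_def by (blast intro: inv_into_f_f)
    then show ?thesis unfolding gg_def using that F_fun by auto
  qed
  have \<kappa>_img: "\<exists>q \<alpha>. F q \<alpha> \<and> i = hg q \<and> gg i = \<alpha>" if i: "i \<in> elts \<kappa>" for i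
  proof -
    obtain q where q: "q \<in> elts A" "i = hg q" using h(3) i unfolding bij_betw_def by auto
    moreover obtain \<alpha> where "F q \<alpha>" using q(1) A_iff by blast
    ultimately show ?thesis using gg by blast
  qed
  have gg_in: "gg ` elts \<kappa> \<subseteq> elts \<mu>" using \<kappa>_img F_in by blast
  have "is_graph g \<kappa> gg"
    unfolding is_graph_def elem_iff
  proof
    fix z
    have "(\<exists>q\<in>elts A. \<exists>\<alpha>. F q \<alpha> \<and> z = pair (hg q) \<alpha>) \<longleftrightarrow> (\<exists>i\<in>elts \<kappa>. z = pair i (gg i))"
    proof
      assume "\<exists>q\<in>elts A. \<exists>\<alpha>. F q \<alpha> \<and> z = pair (hg q) \<alpha>"
      then show "\<exists>i\<in>elts \<kappa>. z = pair i (gg i)" using gg hg(1) by blast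
    next
      assume "\<exists>i\<in>elts \<kappa>. z = pair i (gg i)"
      then obtain i where i: "i \<in> elts \<kappa>" "z = pair i (gg i)" by blast
      obtain q \<alpha> where "F q \<alpha>" "i = hg q" "gg i = \<alpha>" using \<kappa>_img[OF i(1)] by blast
      then show "\<exists>q\<in>elts A. \<exists>\<alpha>. F q \<alpha> \<and> z = pair (hg q) \<alpha>" using i(2) A_iff by blast
    qed
    also have "\<dots> \<longleftrightarrow> (\<exists>i\<in>elts \<kappa>. is_pair z i (gg i))"
      using is_pair_iff elts_in[OF \<kappa>W] \<mu>E gg_in by blast
    finally show "z \<in> elts g \<longleftrightarrow> (\<exists>x. x \<in> elts \<kappa> \<and> is_pair z x (gg x))" using g_iff by blast
  qed
  \<comment> \<open>As \<kappa> lies below the cofinality \<theta>, this map cannot be cofinal in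
    \<mu>; some \<xi> bounds all points at which members of \<open>A\<close> were recorded as
    wrong.\<close>
  then have "\<not> (\<forall>\<xi>\<in>elts \<mu>. \<exists>i\<in>elts \<kappa>. ord_le \<xi> (gg i))"
    using cof g(1) gg_in \<kappa>(2) unfolding has_cofinality_def cofinal_map_exists_def by blast
  then obtain \<xi> where \<xi>: "\<xi> \<in> elts \<mu>" "\<And>i. i \<in> elts \<kappa> \<Longrightarrow> \<not> ord_le \<xi> (gg i)" by blast
  have F_\<xi>: "\<alpha> \<in> elts \<xi>" if "F q \<alpha>" for q \<alpha>
  proof -
    have "\<not> ord_le \<xi> \<alpha>" using \<xi>(2)[OF hg(1)] that A_iff gg[OF that] by metis
    moreover have "is_ordinal \<xi>" "is_ordinal \<alpha>" using is_ordinal_elem[OF \<mu>(2)] \<xi>(1) F_in[OF that] by auto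
    ultimately show ?thesis using is_ordinal_linear unfolding ord_le_def elem_iff by blast
  qed
  obtain p where p: "p \<in> T" and p_in: "\<And>\<alpha>. \<alpha> \<in> elts \<xi> \<Longrightarrow> \<alpha> \<in> elts X \<Longrightarrow> forces_in U p \<alpha>"
    and p_out: "\<And>\<alpha>. \<alpha> \<in> elts \<xi> \<Longrightarrow> \<alpha> \<notin> elts X \<Longrightarrow> forces_out U p \<alpha>"
    using decide[OF \<xi>(1)] by blast
  obtain r p' \<alpha> where r: "r \<in> elts P" "le r p" "p' \<in> T" "\<alpha> \<in> elts \<mu>" "differ U p' r \<alpha>"
    using differs[OF p] by blast
  \<comment> \<open>Maximality of \<open>V\<close> is transferred to the extension. For p'' below
    p', the triple (p'', r, \<alpha>) lies in \<open>S\<close>, so \<open>V\<close> contains it or a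
    triple compatible with it in both conditions. In either case an extension of p'' lies below the
    first coordinate of a triple in \<open>V\<close> whose second is compatible with r; genericity
    finds such an extension in \<open>T\<close>.\<close>
  have "\<exists>p''\<in>T. \<exists>q\<in>elts P. (\<exists>r'\<in>elts P. le r' q \<and> le r' r) \<and>
    (\<exists>\<beta>\<in>elts \<mu>. \<exists>p1\<in>elts P. le p'' p1 \<and> pair p1 (pair q \<beta>) \<in> elts V)"
  proof (rule generic_below[OF _ r(3)])
    show "definable (\<lambda>e. \<exists>q\<in>elts P. (\<exists>r'\<in>elts P. le r' q \<and> le r' r) \<and>
      (\<exists>\<beta>\<in>elts \<mu>. \<exists>p1\<in>elts P. le (e 0) p1 \<and> pair p1 (pair q \<beta>) \<in> elts V))"
      by (intro force_intros \<mu>W V P_elt[OF r(1)])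
    fix p'' assume p'': "p'' \<in> elts P" "le p'' p'"
    have "differ U p'' r \<alpha>"
      using r(5) forces_in_open forces_out_open p''(2) unfolding differ_def by blast
    then have w: "pair p'' (pair r \<alpha>) \<in> S" using S_iff p''(1) r(1,4) by blast
    show "\<exists>s\<in>elts P. le s p'' \<and> (\<exists>q\<in>elts P. (\<exists>r'\<in>elts P. le r' q \<and> le r' r) \<and>
      (\<exists>\<beta>\<in>elts \<mu>. \<exists>p1\<in>elts P. le s p1 \<and> pair p1 (pair q \<beta>) \<in> elts V))"
      using maximal[OF w]
    proof
      assume "pair p'' (pair r \<alpha>) \<in> elts V"
      then show ?thesis using p''(1) r(1,4) le_refl by blast
    next
      assume "\<exists>y\<in>elts V. \<not> Q (pair p'' (pair r \<alpha>)) y"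
      then obtain y p2 r2 \<alpha>2 p1 q \<beta> where y: "y \<in> elts V" "p2 \<in> elts P" "r2 \<in> elts P" "\<alpha>2 \<in> elts \<mu>"
        "p1 \<in> elts P" "q \<in> elts P" "\<beta> \<in> elts \<mu>" "pair p'' (pair r \<alpha>) = pair p2 (pair r2 \<alpha>2)"
        "y = pair p1 (pair q \<beta>)" "compat p2 p1" "compat r2 q"
        unfolding Q_def by blast
      have "p'' = p2 \<and> r = r2 \<and> \<alpha> = \<alpha>2"
        by (rule pair3[OF y(8)]) (use p'' r y P_elt \<mu>E in auto)
      then show ?thesis using y unfolding compatible_def by blast
    qed
  qed
  then obtain p'' q r' \<beta> p1 where q: "p'' \<in> T" "q \<in> elts P" "r' \<in> elts P" "le r' q" "le r' r"
    "\<beta> \<in> elts \<mu>" "p1 \<in> elts P" "le p'' p1" "pair p1 (pair q \<beta>) \<in> elts V" by blast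
  have p1: "p1 \<in> T" using T_upward q(1,7,8) by blast
  have M: "M p1 q \<beta>" unfolding M_def using q by blast
  then have "F q \<beta>" unfolding F_def using p1 by blast
  then have \<beta>: "\<beta> \<in> elts \<xi>" by (rule F_\<xi>)
  \<comment> \<open>Now r' extends both p and q. Since p1 is in \<open>T\<close>, it decides \<beta>
    correctly, and so does p because \<beta> is below \<xi>; but q disagrees with p1 at \<beta>, so
    r' would force both answers.\<close>
  have r'p: "le r' p" using le_trans q(5) r(2) by blast
  show False
    using M_differ[OF M] unfolding differ_def
  proof
    assume *: "forces_in U p1 \<beta> \<and> forces_out U q \<beta>"
    then have "forces_in U p \<beta>" using p_in[OF \<beta>] X_iff p1 by blast
    then show False
      using not_forces_in_out[OF q(3)] forces_in_open r'p forces_out_open q(4) * by blast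
  next
    assume *: "forces_out U p1 \<beta> \<and> forces_in U q \<beta>"
    then have "forces_out U p \<beta>" using p_out[OF \<beta>] not_X p1 by blast
    then show False
      using not_forces_in_out[OF q(3)] forces_out_open r'p forces_in_open q(4) * by blast
  qed
qed

end

theorem theorem5p3:
  fixes W WT :: "'v::set_universe set" and P leq \<theta> :: 'v and T :: "'v set"
  assumes "transitive_class W" and "ZFC_model W"
    and "P \<in> W" and "leq \<in> W" and "forcing_notion P leq"
    and "generic_filter W P leq T"
    and "generic_extension W P T WT"
    and "is_regular_cardinal WT \<theta>"
    and "chain_condition WT P leq \<theta>"
  shows "\<not> (\<exists>\<kappa> X. is_cardinal WT \<kappa> \<and> has_cofinality WT \<kappa> \<theta> \<and> fresh_subset W WT X \<kappa>)"
proof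
  obtain val where val: "\<forall>\<tau>\<in>W. P_name P \<tau> \<longrightarrow>
      elts (val \<tau>) = {val \<sigma> | \<sigma> p. p \<in> T \<and> (\<sigma>, p) \<in> rel_of \<tau>}"
    "WT = val ` {\<tau> \<in> W. P_name P \<tau>}"
    using assms(7) unfolding generic_extension_def by blast
  interpret generic_ext W P leq T WT val
    by unfold_locales (use assms(1-6) val in auto)
  assume "\<exists>\<kappa> X. is_cardinal WT \<kappa> \<and> has_cofinality WT \<kappa> \<theta> \<and> fresh_subset W WT X \<kappa>"
  then obtain \<kappa> X where \<kappa>: "is_cardinal WT \<kappa>" "has_cofinality WT \<kappa> \<theta>"
    and X: "fresh_subset W WT X \<kappa>" by blast
  obtain s where s: "is_sup X s" "\<And>\<alpha>. \<alpha> \<in> elts s \<Longrightarrow> \<exists>y\<in>W. elts y = elts X \<inter> elts \<alpha>"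
    using X unfolding fresh_subset_def fresh_def by blast
  have "s = \<kappa>" using X s(1) is_sup_unique unfolding fresh_subset_def by blast
  show False
  proof (rule no_fresh[of \<kappa> X \<theta>])
    show "\<exists>y\<in>W. elts y = elts X \<inter> elts \<xi>" if "\<xi> \<in> elts \<kappa>" for \<xi>
      using s(2) that \<open>s = \<kappa>\<close> by simp
  qed (use \<kappa> X assms(9) in \<open>auto simp: is_cardinal_def fresh_subset_def fresh_def\<close>)
qed

end
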